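(* Let $\mathfrak g=\mathfrak s\oplus\mathfrak z\oplus\mathfrak u$, $\mathfrak u=\bigoplus_{\ell=1}^mP_\ell$, be a nondegenerate flat metric Lie algebra, $G$ the simply connected Lie group with Lie algebra $\mathfrak g$, and $N=\exp(\mathfrak z\oplus\mathfrak u)$. Let $\xi=\mathrm{ad}\,r+R$ be a Lie bialgebra structure on $\mathfrak g$ with $r\in\wedge^2\mathfrak g$ and $R$ a normalized $1$-cocycle, and let $\pi$ be the corresponding multiplicative Poisson tensor on $G$, with right trivialization $\Pi:G\to\wedge^2\mathfrak g$. Then, along $N$, the coefficients of $\pi$ in exponential coordinates of $N$ are polynomials of degree at most $2$; that is, the coefficients of $u\mapsto\Pi(\exp u)\in\wedge^2\mathfrak g$, $u\in\mathfrak z\oplus\mathfrak u$, with respect to a basis of $\wedge^2\mathfrak g$ are polynomials of degree at most $2$ in the linear coordinates of $u$.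
   Context: All Lie algebras are finite-dimensional and real. A flat metric Lie algebra is a Lie algebra $\mathfrak g$ with an inner product $\langle\cdot,\cdot\rangle$ such that the left-invariant Riemannian metric it induces on the simply connected Lie group of $\mathfrak g$ has zero curvature. By Milnor's theorem there is an orthogonal decomposition $\mathfrak g=\mathfrak s\oplus\mathfrak z\oplus\mathfrak u$, where $\mathfrak s$ is an abelian subalgebra, $\mathfrak z$ is the center of $\mathfrak g$, $\mathfrak u=[\mathfrak g,\mathfrak g]$ is an even-dimensional abelian ideal, and the operators $\mathrm{ad}_s|_{\mathfrak u}$ ($s\in\mathfrak s$) are skew-symmetric and commute pairwise. Moreover $\mathfrak u=\bigoplus_{\ell=1}^m P_\ell$ orthogonally, where the $P_\ell$ are $2$-dimensional and $\mathfrak s$-invariant, and there are nonzero weights $\lambda_\ell\in\mathfrak s^*\setminus\{0\}$ and orthogonal complex structures $J_\ell\in \mathrm{SO}(P_\ell)$ with $[s,v]=\lambda_\ell(s)J_\ell v$ for $s\in\mathfrak s$, $v\in P_\ell$. $\mathfrak g$ is called nondegenerate if: (a) $\lambda_i\neq\pm\lambda_j$ for all $i\neq j$; (b) for any pairwise distinct $i,j,k$ there is no relation $\lambda_k=a\lambda_i+b\lambda_j$ with $a,b\in\{-1,0,1\}$. For $x\in\mathfrak g$, $\mathrm{ad}_x$ is extended to $\wedge^k\mathfrak g$ as a derivation, and $\mathrm{Ad}_g$ to $\wedge^k\mathfrak g$ multiplicatively; $(\wedge^2\mathfrak g)^{\mathfrak g}$ is the space of bivectors killed by all $\mathrm{ad}_x$.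 A $1$-cocycle $R:\mathfrak g\to\wedge^2\mathfrak g$ is a linear map with $R([x,y])=\mathrm{ad}_xR(y)-\mathrm{ad}_yR(x)$; it is normalized if $R(\mathfrak s\oplus\mathfrak z)\subset(\wedge^2\mathfrak g)^{\mathfrak g}$ and $R(P_\ell)\subset(\mathfrak s\wedge P_\ell)\oplus(\mathfrak z\wedge P_\ell)$ for each $\ell$. $\mathrm{ad}\,r$ denotes $x\mapsto\mathrm{ad}_xr$. A Lie bialgebra structure on $\mathfrak g$ is a $1$-cocycle $\xi:\mathfrak g\to\wedge^2\mathfrak g$ whose transpose is a Lie bracket on $\mathfrak g^*$. The multiplicative Poisson tensor $\pi$ corresponding to $\xi$ is $\pi(g)=(R_g)_*\Pi(g)$, where $R_g$ is right translation by $g$ and $\Pi:G\to\wedge^2\mathfrak g$ is the unique smooth map with $\Pi(gh)=\Pi(g)+\mathrm{Ad}_g\Pi(h)$ and $d_e\Pi=\xi$. The nilradical $N=\exp(\mathfrak z\oplus\mathfrak u)$ is abelian and $\exp:\mathfrak z\oplus\mathfrak u\to N$ is a diffeomorphism, giving exponential coordinates on $N$. *)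

theory Defs
  imports "HOL-Analysis.Analysis" "HOL-Algebra.Group"
begin

section \<open>Smooth manifolds\<close>

text \<open>Only used for open \<open>S\<close>: \<open>frechet_derivative f (at x)\<close> is then the derivative of \<open>f\<close> at \<open>x\<close>
  and depends only on the restriction of \<open>f\<close> to \<open>S\<close>.\<close>

primrec Ck_on :: "nat \<Rightarrow> 'a::euclidean_space set \<Rightarrow> ('a \<Rightarrow> 'b::real_normed_vector) \<Rightarrow> bool" where
  "Ck_on 0 S f \<longleftrightarrow> continuous_on S f"
| "Ck_on (Suc k) S f \<longleftrightarrow> (\<forall>x\<in>S. f differentiable (at x)) \<and>
     (\<forall>v. Ck_on k S (\<lambda>x. frechet_derivative f (at x) v))"

definition smooth_on :: "'a::euclidean_space set \<Rightarrow> ('a \<Rightarrow> 'b::real_normed_vector) \<Rightarrow> bool" where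
  "smooth_on S f \<longleftrightarrow> (\<forall>k. Ck_on k S f)"

text \<open>A chart is a pair of its (open) domain and a coordinate map that is only relevant on that
  domain. The manifolds are whole types; the Hausdorff property and second countability are
  imposed by type classes.\<close>

type_synonym ('a, 'e) chart = "'a set \<times> ('a \<Rightarrow> 'e)"

definition smooth_atlas :: "('a::topological_space, 'e::euclidean_space) chart set \<Rightarrow> bool" where
  "smooth_atlas A \<longleftrightarrow>
     (\<Union>(U, \<phi>)\<in>A. U) = UNIV \<and>
     (\<forall>(U, \<phi>)\<in>A. open U \<and> open (\<phi> ` U) \<and> homeomorphism U (\<phi> ` U) \<phi> (inv_into U \<phi>)) \<and>
     (\<forall>(U, \<phi>)\<in>A. \<forall>(V, \<psi>)\<in>A. smooth_on (\<phi> ` (U \<inter> V)) (\<psi> \<circ> inv_into U \<phi>))"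

definition prod_atlas ::
  "('a, 'e) chart set \<Rightarrow> ('b, 'f) chart set \<Rightarrow> ('a \<times> 'b, 'e \<times> 'f) chart set" where
  "prod_atlas A B = {(U \<times> V, map_prod \<phi> \<psi>) | U \<phi> V \<psi>. (U, \<phi>) \<in> A \<and> (V, \<psi>) \<in> B}"

definition vector_atlas :: "('e, 'e) chart set" where
  "vector_atlas = {(UNIV, id)}"

definition smooth_map :: "('a::topological_space, 'e::euclidean_space) chart set \<Rightarrow>
    ('b::topological_space, 'f::euclidean_space) chart set \<Rightarrow> ('a \<Rightarrow> 'b) \<Rightarrow> bool" where
  "smooth_map A B F \<longleftrightarrow> continuous_on UNIV F \<and>
     (\<forall>(U, \<phi>)\<in>A. \<forall>(V, \<psi>)\<in>B. smooth_on (\<phi> ` (U \<inter> F -` V)) (\<psi> \<circ> F \<circ> inv_into U \<phi>))"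

definition smooth_fun ::
  "('a, 'e::euclidean_space) chart set \<Rightarrow> ('a \<Rightarrow> 'b::real_normed_vector) \<Rightarrow> bool" where
  "smooth_fun A f \<longleftrightarrow> (\<forall>(U, \<phi>)\<in>A. smooth_on (\<phi> ` U) (f \<circ> inv_into U \<phi>))"


section \<open>Vector fields and connections\<close>

text \<open>Vector fields are the derivations of the algebra of smooth real functions. They are
  totalised by the value 0 on functions that are not smooth, so that equality of vector fields
  is equality of HOL functions.\<close>

type_synonym 'a vfield = "('a \<Rightarrow> real) \<Rightarrow> 'a \<Rightarrow> real"

definition vector_field :: "('a, 'e::euclidean_space) chart set \<Rightarrow> 'a vfield \<Rightarrow> bool" where
  "vector_field A X \<longleftrightarrow>
     (\<forall>f. smooth_fun A f \<longrightarrow> smooth_fun A (X f)) \<and>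
     (\<forall>f h a b. smooth_fun A f \<longrightarrow> smooth_fun A h \<longrightarrow>
        X (\<lambda>p. a * f p + b * h p) = (\<lambda>p. a * X f p + b * X h p)) \<and>
     (\<forall>f h. smooth_fun A f \<longrightarrow> smooth_fun A h \<longrightarrow>
        X (\<lambda>p. f p * h p) = (\<lambda>p. f p * X h p + h p * X f p)) \<and>
     (\<forall>f. \<not> smooth_fun A f \<longrightarrow> X f = (\<lambda>p. 0))"

definition vf_add :: "'a vfield \<Rightarrow> 'a vfield \<Rightarrow> 'a vfield" where
  "vf_add X Y = (\<lambda>f p. X f p + Y f p)"

definition vf_diff :: "'a vfield \<Rightarrow> 'a vfield \<Rightarrow> 'a vfield" where
  "vf_diff X Y = (\<lambda>f p. X f p - Y f p)"

definition vf_scale :: "('a \<Rightarrow> real) \<Rightarrow> 'a vfield \<Rightarrow> 'a vfield" where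
  "vf_scale h X = (\<lambda>f p. h p * X f p)"

definition vf_bracket :: "'a vfield \<Rightarrow> 'a vfield \<Rightarrow> 'a vfield" where
  "vf_bracket X Y = (\<lambda>f p. X (Y f) p - Y (X f) p)"

definition affine_connection ::
  "('a, 'e::euclidean_space) chart set \<Rightarrow> ('a vfield \<Rightarrow> 'a vfield \<Rightarrow> 'a vfield) \<Rightarrow> bool" where
  "affine_connection A D \<longleftrightarrow>
     (\<forall>X Y. vector_field A X \<longrightarrow> vector_field A Y \<longrightarrow> vector_field A (D X Y)) \<and>
     (\<forall>X X' Y. vector_field A X \<longrightarrow> vector_field A X' \<longrightarrow> vector_field A Y \<longrightarrow>
        D (vf_add X X') Y = vf_add (D X Y) (D X' Y)) \<and>
     (\<forall>X Y Y'. vector_field A X \<longrightarrow> vector_field A Y \<longrightarrow> vector_field A Y' \<longrightarrow>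
        D X (vf_add Y Y') = vf_add (D X Y) (D X Y')) \<and>
     (\<forall>h X Y. smooth_fun A h \<longrightarrow> vector_field A X \<longrightarrow> vector_field A Y \<longrightarrow>
        D (vf_scale h X) Y = vf_scale h (D X Y) \<and>
        D X (vf_scale h Y) = vf_add (vf_scale (X h) Y) (vf_scale h (D X Y)))"


section \<open>Lie algebras and bivectors\<close>

definition lie_bracket :: "('v::real_vector \<Rightarrow> 'v \<Rightarrow> 'v) \<Rightarrow> bool" where
  "lie_bracket br \<longleftrightarrow> bilinear br \<and> (\<forall>x. br x x = 0) \<and>
     (\<forall>x y z. br x (br y z) + br y (br z x) + br z (br x y) = 0)"

definition lie_center :: "('v::real_vector \<Rightarrow> 'v \<Rightarrow> 'v) \<Rightarrow> 'v set" where
  "lie_center br = {x. \<forall>y. br x y = 0}"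

definition derived_algebra :: "('v::real_vector \<Rightarrow> 'v \<Rightarrow> 'v) \<Rightarrow> 'v set" where
  "derived_algebra br = span {br x y | x y. True}"

text \<open>The second exterior power of a finite-dimensional space \<open>'g\<close> is realised as the space of
  alternating bilinear forms on the dual of \<open>'g\<close>, with \<open>x \<and> y\<close> corresponding to
  \<open>x \<otimes> y - y \<otimes> x\<close>.\<close>

type_synonym 'g dual = "'g \<Rightarrow>\<^sub>L real"
type_synonym 'g bivec = "'g dual \<Rightarrow>\<^sub>L 'g dual \<Rightarrow>\<^sub>L real"

definition bivectors :: "'g::euclidean_space bivec set" where
  "bivectors = {b :: 'g bivec. \<forall>\<alpha> :: 'g dual. b \<alpha> \<alpha> = 0}"

definition wedge :: "'g::euclidean_space \<Rightarrow> 'g \<Rightarrow> 'g bivec" where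
  "wedge x y = Blinfun (\<lambda>\<alpha> :: 'g dual. Blinfun (\<lambda>\<beta> :: 'g dual. \<alpha> x * \<beta> y - \<alpha> y * \<beta> x))"

definition wedge_space :: "'g::euclidean_space set \<Rightarrow> 'g set \<Rightarrow> 'g bivec set" where
  "wedge_space V W = span {wedge v w | v w. v \<in> V \<and> w \<in> W}"

definition pullback :: "('g::euclidean_space \<Rightarrow> 'g) \<Rightarrow> 'g dual \<Rightarrow> 'g dual" where
  "pullback T \<alpha> = Blinfun (\<lambda>x. \<alpha> (T x))"

text \<open>The extensions of a linear map \<open>T\<close> of \<open>'g\<close> to bivectors as a derivation, i.e.
  \<open>x \<and> y \<mapsto> T x \<and> y + x \<and> T y\<close>, and multiplicatively, i.e. \<open>x \<and> y \<mapsto> T x \<and> T y\<close>.\<close>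

definition ext_der :: "('g::euclidean_space \<Rightarrow> 'g) \<Rightarrow> 'g bivec \<Rightarrow> 'g bivec" where
  "ext_der T b = Blinfun (\<lambda>\<alpha> :: 'g dual. Blinfun (\<lambda>\<beta> :: 'g dual. b (pullback T \<alpha>) \<beta> + b \<alpha> (pullback T \<beta>)))"

definition ext_mult :: "('g::euclidean_space \<Rightarrow> 'g) \<Rightarrow> 'g bivec \<Rightarrow> 'g bivec" where
  "ext_mult T b = Blinfun (\<lambda>\<alpha> :: 'g dual. Blinfun (\<lambda>\<beta> :: 'g dual. b (pullback T \<alpha>) (pullback T \<beta>)))"

lemma blinfun2_apply:
  fixes h :: "'g::euclidean_space dual \<Rightarrow> 'g dual \<Rightarrow> real" and c :: "'g bivec"
  assumes "\<And>\<alpha> \<beta>. h \<alpha> \<beta> = c \<alpha> \<beta>"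
  shows "Blinfun (\<lambda>\<alpha>. Blinfun (h \<alpha>)) \<alpha> \<beta> = h \<alpha> \<beta>"
proof -
  have "h \<alpha> = blinfun_apply (c \<alpha>)" for \<alpha>
    using assms by blast
  then show ?thesis
    by (simp add: blinfun_apply_inverse)
qed

lemma bounded_bilinear_bivec:
  fixes h :: "'g::euclidean_space dual \<Rightarrow> 'g dual \<Rightarrow> real"
  assumes "bounded_bilinear h"
  shows "\<exists>c :: 'g bivec. \<forall>\<alpha> \<beta>. c \<alpha> \<beta> = h \<alpha> \<beta>"
proof -
  interpret bounded_bilinear h by fact
  have "Blinfun prod_right \<alpha> \<beta> = h \<alpha> \<beta>" for \<alpha> \<beta>
    by (simp add: bounded_linear_Blinfun_apply bounded_linear_prod_right prod_right.rep_eq)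
  then show ?thesis by blast
qed

lemma bounded_bilinear_bivec_apply:
  fixes b :: "'g::euclidean_space bivec"
  shows "bounded_bilinear (\<lambda>\<alpha> \<beta>. blinfun_apply (blinfun_apply b \<alpha>) \<beta>)"
  by (rule bounded_bilinear.comp1[OF bounded_bilinear_blinfun_apply blinfun.bounded_linear_right])

lemma pullback_eq:
  assumes "linear T"
  shows "pullback T \<alpha> = \<alpha> o\<^sub>L Blinfun T"
proof -
  have T: "bounded_linear T" using assms by (simp add: linear_conv_bounded_linear)
  show ?thesis
    unfolding pullback_def
    by (rule blinfun_eqI)
       (simp add: bounded_linear_Blinfun_apply T bounded_linear_compose[OF blinfun.bounded_linear_right T])
qed

lemma pullback_apply: "linear T \<Longrightarrow> pullback T \<alpha> x = \<alpha> (T x)"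
  by (simp add: pullback_eq bounded_linear_Blinfun_apply linear_conv_bounded_linear)

lemma bounded_linear_pullback: "linear T \<Longrightarrow> bounded_linear (pullback T)"
  using bounded_bilinear.bounded_linear_left[OF bounded_bilinear_blinfun_compose]
  by (subst ext[of "pullback T", OF pullback_eq])

lemma wedge_apply:
  fixes \<alpha> \<beta> :: "'g::euclidean_space dual"
  shows "wedge x y \<alpha> \<beta> = \<alpha> x * \<beta> y - \<alpha> y * \<beta> x"
proof -
  have *: "bounded_bilinear (\<lambda>(\<alpha>::'g dual) (\<beta>::'g dual). \<alpha> u * \<beta> v)" for u v
    by (rule bounded_bilinear.comp[OF bounded_bilinear_mult blinfun.bounded_linear_left blinfun.bounded_linear_left])
  obtain c :: "'g bivec" where c: "\<And>\<alpha> \<beta>. c \<alpha> \<beta> = \<alpha> x * \<beta> y"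
    using bounded_bilinear_bivec[OF *[of x y]] by blast
  obtain d :: "'g bivec" where d: "\<And>\<alpha> \<beta>. d \<alpha> \<beta> = \<alpha> y * \<beta> x"
    using bounded_bilinear_bivec[OF *[of y x]] by blast
  show ?thesis
    unfolding wedge_def
    by (rule blinfun2_apply[where c = "c - d"]) (simp add: c d blinfun.diff_left)
qed

lemma ext_der_apply:
  fixes T :: "'g::euclidean_space \<Rightarrow> 'g" and \<alpha> \<beta> :: "'g dual"
  assumes "linear T"
  shows "ext_der T b \<alpha> \<beta> = b (pullback T \<alpha>) \<beta> + b \<alpha> (pullback T \<beta>)"
proof -
  note bb = bounded_bilinear_bivec_apply[of b] and T = bounded_linear_pullback[OF assms]
  obtain c :: "'g bivec" where c: "\<And>\<alpha> \<beta>. c \<alpha> \<beta> = b (pullback T \<alpha>) \<beta>"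
    using bounded_bilinear_bivec[OF bounded_bilinear.comp1[OF bb T]] by blast
  obtain d :: "'g bivec" where d: "\<And>\<alpha> \<beta>. d \<alpha> \<beta> = b \<alpha> (pullback T \<beta>)"
    using bounded_bilinear_bivec[OF bounded_bilinear.comp[OF bb bounded_linear_ident T]] by blast
  show ?thesis
    unfolding ext_der_def
    by (rule blinfun2_apply[where c = "c + d"]) (simp add: c d blinfun.add_left)
qed

lemma ext_mult_apply:
  fixes T :: "'g::euclidean_space \<Rightarrow> 'g" and \<alpha> \<beta> :: "'g dual"
  assumes "linear T"
  shows "ext_mult T b \<alpha> \<beta> = b (pullback T \<alpha>) (pullback T \<beta>)"
proof -
  note bb = bounded_bilinear_bivec_apply[of b] and T = bounded_linear_pullback[OF assms]
  obtain c :: "'g bivec" where c: "\<And>\<alpha> \<beta>. c \<alpha> \<beta> = b (pullback T \<alpha>) (pullback T \<beta>)"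
    using bounded_bilinear_bivec[OF bounded_bilinear.comp[OF bb T T]] by blast
  show ?thesis
    unfolding ext_mult_def
    by (rule blinfun2_apply[where c = c]) (simp add: c)
qed

definition invariant_bivectors :: "('g::euclidean_space \<Rightarrow> 'g \<Rightarrow> 'g) \<Rightarrow> 'g bivec set" where
  "invariant_bivectors br = {b \<in> bivectors. \<forall>x. ext_der (br x) b = 0}"

definition cocycle :: "('g::euclidean_space \<Rightarrow> 'g \<Rightarrow> 'g) \<Rightarrow> ('g \<Rightarrow> 'g bivec) \<Rightarrow> bool" where
  "cocycle br R \<longleftrightarrow> linear R \<and> range R \<subseteq> bivectors \<and>
     (\<forall>x y. R (br x y) = ext_der (br x) (R y) - ext_der (br y) (R x))"

definition dual_bracket :: "('g::euclidean_space \<Rightarrow> 'g bivec) \<Rightarrow> 'g dual \<Rightarrow> 'g dual \<Rightarrow> 'g dual" where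
  "dual_bracket \<xi> \<alpha> \<beta> = Blinfun (\<lambda>x. \<xi> x \<alpha> \<beta>)"

definition lie_bialgebra_structure ::
  "('g::euclidean_space \<Rightarrow> 'g \<Rightarrow> 'g) \<Rightarrow> ('g \<Rightarrow> 'g bivec) \<Rightarrow> bool" where
  "lie_bialgebra_structure br \<xi> \<longleftrightarrow> cocycle br \<xi> \<and> lie_bracket (dual_bracket \<xi>)"


section \<open>The structure of flat metric Lie algebras\<close>

text \<open>\<open>w \<ell>\<close> and \<open>J \<ell>\<close> are the weight and the complex structure belonging to \<open>P \<ell>\<close>,
  \<open>1 \<le> \<ell> \<le> m\<close>; they are linear maps on all of \<open>'g\<close> of which only the restrictions to \<open>s\<close> and
  to \<open>P \<ell>\<close> matter. An orthogonal map of the plane \<open>P \<ell>\<close> with square \<open>-1\<close> automatically has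
  determinant 1.\<close>

definition milnor_decomposition :: "('g::euclidean_space \<Rightarrow> 'g \<Rightarrow> 'g) \<Rightarrow> 'g set \<Rightarrow> nat \<Rightarrow>
    (nat \<Rightarrow> 'g set) \<Rightarrow> (nat \<Rightarrow> 'g \<Rightarrow> real) \<Rightarrow> (nat \<Rightarrow> 'g \<Rightarrow> 'g) \<Rightarrow> bool" where
  "milnor_decomposition br s m P w J \<longleftrightarrow>
    (let z = lie_center br; u = derived_algebra br in
      subspace s \<and> (\<forall>x\<in>s. \<forall>y\<in>s. br x y = 0) \<and>
      (\<forall>x\<in>s. \<forall>y\<in>z. x \<bullet> y = 0) \<and> (\<forall>x\<in>s. \<forall>y\<in>u. x \<bullet> y = 0) \<and> (\<forall>x\<in>z. \<forall>y\<in>u. x \<bullet> y = 0) \<and>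
      (\<forall>x. \<exists>a\<in>s. \<exists>b\<in>z. \<exists>c\<in>u. x = a + b + c) \<and>
      even (dim u) \<and> (\<forall>x\<in>u. \<forall>y\<in>u. br x y = 0) \<and> (\<forall>x. \<forall>y\<in>u. br x y \<in> u) \<and>
      (\<forall>a\<in>s. \<forall>x\<in>u. \<forall>y\<in>u. br a x \<bullet> y = - (x \<bullet> br a y)) \<and>
      (\<forall>a\<in>s. \<forall>b\<in>s. \<forall>x\<in>u. br a (br b x) = br b (br a x)) \<and>
      (\<forall>l\<in>{1..m}. subspace (P l) \<and> dim (P l) = 2 \<and> (\<forall>a\<in>s. \<forall>v\<in>P l. br a v \<in> P l)) \<and>
      (\<forall>i\<in>{1..m}. \<forall>j\<in>{1..m}. i \<noteq> j \<longrightarrow> (\<forall>x\<in>P i. \<forall>y\<in>P j. x \<bullet> y = 0)) \<and>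
      u = span (\<Union>l\<in>{1..m}. P l) \<and>
      (\<forall>l\<in>{1..m}. linear (w l) \<and> (\<exists>a\<in>s. w l a \<noteq> 0)) \<and>
      (\<forall>l\<in>{1..m}. linear (J l) \<and>
         (\<forall>v\<in>P l. J l v \<in> P l \<and> J l (J l v) = - v) \<and>
         (\<forall>v\<in>P l. \<forall>v'\<in>P l. J l v \<bullet> J l v' = v \<bullet> v')) \<and>
      (\<forall>l\<in>{1..m}. \<forall>a\<in>s. \<forall>v\<in>P l. br a v = w l a *\<^sub>R J l v))"

definition nondegenerate_weights :: "'g set \<Rightarrow> nat \<Rightarrow> (nat \<Rightarrow> 'g \<Rightarrow> real) \<Rightarrow> bool" where
  "nondegenerate_weights s m w \<longleftrightarrow>
     (\<forall>i\<in>{1..m}. \<forall>j\<in>{1..m}. i \<noteq> j \<longrightarrow>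
        \<not> (\<forall>x\<in>s. w i x = w j x) \<and> \<not> (\<forall>x\<in>s. w i x = - w j x)) \<and>
     (\<forall>i\<in>{1..m}. \<forall>j\<in>{1..m}. \<forall>k\<in>{1..m}. i \<noteq> j \<and> j \<noteq> k \<and> i \<noteq> k \<longrightarrow>
        (\<forall>a\<in>{-1, 0, 1}. \<forall>b\<in>{-1, 0, 1}. \<not> (\<forall>x\<in>s. w k x = a * w i x + b * w j x)))"

definition normalized_cocycle :: "('g::euclidean_space \<Rightarrow> 'g \<Rightarrow> 'g) \<Rightarrow> 'g set \<Rightarrow> nat \<Rightarrow>
    (nat \<Rightarrow> 'g set) \<Rightarrow> ('g \<Rightarrow> 'g bivec) \<Rightarrow> bool" where
  "normalized_cocycle br s m P R \<longleftrightarrow> cocycle br R \<and>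
     (\<forall>x\<in>s. \<forall>y\<in>lie_center br. R (x + y) \<in> invariant_bivectors br) \<and>
     (\<forall>l\<in>{1..m}. \<forall>v\<in>P l. \<exists>b\<in>wedge_space s (P l). \<exists>c\<in>wedge_space (lie_center br) (P l). R v = b + c)"


section \<open>Lie groups\<close>

definition lie_group :: "('a::{t2_space, second_countable_topology}) monoid \<Rightarrow>
    ('a, 'e::euclidean_space) chart set \<Rightarrow> bool" where
  "lie_group G A \<longleftrightarrow> group G \<and> carrier G = UNIV \<and> smooth_atlas A \<and>
     smooth_map (prod_atlas A A) A (\<lambda>(g, h). g \<otimes>\<^bsub>G\<^esub> h) \<and>
     smooth_map A A (\<lambda>g. inv\<^bsub>G\<^esub> g)"

definition left_invariant ::
  "'a monoid \<Rightarrow> ('a, 'e::euclidean_space) chart set \<Rightarrow> 'a vfield \<Rightarrow> bool" where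
  "left_invariant G A X \<longleftrightarrow>
     (\<forall>g f. smooth_fun A f \<longrightarrow> X (\<lambda>h. f (g \<otimes>\<^bsub>G\<^esub> h)) = (\<lambda>h. X f (g \<otimes>\<^bsub>G\<^esub> h)))"

text \<open>\<open>L\<close> is an isomorphism from the Lie algebra \<open>('g, br)\<close> onto the Lie algebra of left-invariant
  vector fields on \<open>G\<close>. The tangent vector at the identity belonging to \<open>x\<close> is
  \<open>f \<mapsto> L x f \<one>\<close>.\<close>

definition lie_algebra_of :: "'a monoid \<Rightarrow> ('a, 'e::euclidean_space) chart set \<Rightarrow>
    ('g::euclidean_space \<Rightarrow> 'g \<Rightarrow> 'g) \<Rightarrow> ('g \<Rightarrow> 'a vfield) \<Rightarrow> bool" where
  "lie_algebra_of G A br L \<longleftrightarrow>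
     bij_betw L UNIV {X. vector_field A X \<and> left_invariant G A X} \<and>
     (\<forall>a b x y f p. L (a *\<^sub>R x + b *\<^sub>R y) f p = a * L x f p + b * L y f p) \<and>
     (\<forall>x y. L (br x y) = vf_bracket (L x) (L y))"

definition maurer_cartan :: "('g \<Rightarrow> 'a vfield) \<Rightarrow> 'a vfield \<Rightarrow> 'a \<Rightarrow> 'g" where
  "maurer_cartan L X p = (THE x. \<forall>f. L x f p = X f p)"

definition left_invariant_metric ::
  "('g::euclidean_space \<Rightarrow> 'a vfield) \<Rightarrow> 'a vfield \<Rightarrow> 'a vfield \<Rightarrow> 'a \<Rightarrow> real" where
  "left_invariant_metric L X Y p = maurer_cartan L X p \<bullet> maurer_cartan L Y p"

definition levi_civita :: "('a, 'e::euclidean_space) chart set \<Rightarrow>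
    ('a vfield \<Rightarrow> 'a vfield \<Rightarrow> 'a \<Rightarrow> real) \<Rightarrow> ('a vfield \<Rightarrow> 'a vfield \<Rightarrow> 'a vfield) \<Rightarrow> bool" where
  "levi_civita A \<mu> D \<longleftrightarrow> affine_connection A D \<and>
     (\<forall>X Y. vector_field A X \<longrightarrow> vector_field A Y \<longrightarrow>
        vf_diff (D X Y) (D Y X) = vf_bracket X Y) \<and>
     (\<forall>X Y Z. vector_field A X \<longrightarrow> vector_field A Y \<longrightarrow> vector_field A Z \<longrightarrow>
        X (\<mu> Y Z) = (\<lambda>p. \<mu> (D X Y) Z p + \<mu> Y (D X Z) p))"

definition flat_metric :: "('a, 'e::euclidean_space) chart set \<Rightarrow>
    ('a vfield \<Rightarrow> 'a vfield \<Rightarrow> 'a \<Rightarrow> real) \<Rightarrow> bool" where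
  "flat_metric A \<mu> \<longleftrightarrow> (\<exists>D. levi_civita A \<mu> D \<and>
     (\<forall>X Y Z. vector_field A X \<longrightarrow> vector_field A Y \<longrightarrow> vector_field A Z \<longrightarrow>
        vf_diff (D X (D Y Z)) (D Y (D X Z)) = D (vf_bracket X Y) Z))"

definition one_param_subgroup :: "('a::topological_space) monoid \<Rightarrow>
    ('a, 'e::euclidean_space) chart set \<Rightarrow> (real \<Rightarrow> 'a) \<Rightarrow> bool" where
  "one_param_subgroup G A c \<longleftrightarrow> smooth_map vector_atlas A c \<and> (\<forall>t t'. c (t + t') = c t \<otimes>\<^bsub>G\<^esub> c t')"

text \<open>\<open>E\<close> is the exponential map: \<open>t \<mapsto> E (t x)\<close> is the one-parameter subgroup with initial
  velocity \<open>x\<close>, for every \<open>x\<close>.\<close>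

definition exponential_map :: "('a::topological_space) monoid \<Rightarrow>
    ('a, 'e::euclidean_space) chart set \<Rightarrow> ('g::euclidean_space \<Rightarrow> 'a vfield) \<Rightarrow> ('g \<Rightarrow> 'a) \<Rightarrow> bool" where
  "exponential_map G A L E \<longleftrightarrow>
     (\<forall>x. one_param_subgroup G A (\<lambda>t. E (t *\<^sub>R x)) \<and>
        (\<forall>f. smooth_fun A f \<longrightarrow>
           ((\<lambda>t. f (E (t *\<^sub>R x))) has_real_derivative L x f \<one>\<^bsub>G\<^esub>) (at 0)))"

text \<open>The differential at the identity of conjugation by \<open>g\<close>.\<close>

definition Ad :: "'a monoid \<Rightarrow> ('a, 'e::euclidean_space) chart set \<Rightarrow>
    ('g::euclidean_space \<Rightarrow> 'a vfield) \<Rightarrow> 'a \<Rightarrow> 'g \<Rightarrow> 'g" where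
  "Ad G A L g x = (THE y. \<forall>f. smooth_fun A f \<longrightarrow>
     L y f \<one>\<^bsub>G\<^esub> = L x (\<lambda>h. f (g \<otimes>\<^bsub>G\<^esub> h \<otimes>\<^bsub>G\<^esub> inv\<^bsub>G\<^esub> g)) \<one>\<^bsub>G\<^esub>)"

text \<open>The differential at the identity of \<open>f \<circ> R\<^sub>g\<close>, where \<open>R\<^sub>g\<close> is right translation by \<open>g\<close>.\<close>

definition right_differential :: "'a monoid \<Rightarrow> ('g::euclidean_space \<Rightarrow> 'a vfield) \<Rightarrow> 'a \<Rightarrow>
    ('a \<Rightarrow> real) \<Rightarrow> 'g dual" where
  "right_differential G L g f = Blinfun (\<lambda>x. L x (\<lambda>h. f (h \<otimes>\<^bsub>G\<^esub> g)) \<one>\<^bsub>G\<^esub>)"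

text \<open>The bivector field \<open>\<pi>\<close> is given by its values \<open>\<pi> f h g = \<pi>(g)(df, dh)\<close> on pairs of smooth
  functions, i.e. by the associated (Poisson) bracket of functions, and \<open>Q\<close> is its right
  trivialization: the last conjunct says that \<open>\<pi>(g)\<close> is the push-forward of \<open>Q g\<close> under \<open>R\<^sub>g\<close>.
  The differential of \<open>Q\<close> at the identity is taken componentwise.\<close>

definition multiplicative_poisson_tensor :: "'a monoid \<Rightarrow> ('a, 'e::euclidean_space) chart set \<Rightarrow>
    ('g::euclidean_space \<Rightarrow> 'a vfield) \<Rightarrow> ('g \<Rightarrow> 'g bivec) \<Rightarrow>
    (('a \<Rightarrow> real) \<Rightarrow> ('a \<Rightarrow> real) \<Rightarrow> 'a \<Rightarrow> real) \<Rightarrow> ('a \<Rightarrow> 'g bivec) \<Rightarrow> bool" where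
  "multiplicative_poisson_tensor G A L \<xi> \<pi> Q \<longleftrightarrow>
     range Q \<subseteq> bivectors \<and> smooth_fun A Q \<and>
     (\<forall>g h. Q (g \<otimes>\<^bsub>G\<^esub> h) = Q g + ext_mult (Ad G A L g) (Q h)) \<and>
     (\<forall>x (\<alpha> :: 'g dual) (\<beta> :: 'g dual). L x (\<lambda>g. Q g \<alpha> \<beta>) \<one>\<^bsub>G\<^esub> = \<xi> x \<alpha> \<beta>) \<and>
     (\<forall>f h g. smooth_fun A f \<longrightarrow> smooth_fun A h \<longrightarrow>
        \<pi> f h g = Q g (right_differential G L g f) (right_differential G L g h))"


section \<open>Polynomial functions on a subspace\<close>

definition basis_of :: "'v::real_vector set \<Rightarrow> 'v set \<Rightarrow> bool" where
  "basis_of B V \<longleftrightarrow> independent B \<and> span B = V"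

text \<open>\<open>f\<close> is, on the span of the finite basis \<open>C\<close>, a polynomial of degree at most \<open>d\<close> in the linear
  coordinates with respect to \<open>C\<close>; \<open>e\<close> ranges over the multi-indices.\<close>

definition polynomial_of_degree_le :: "nat \<Rightarrow> 'v::real_vector set \<Rightarrow> ('v \<Rightarrow> real) \<Rightarrow> bool" where
  "polynomial_of_degree_le d C f \<longleftrightarrow> (\<exists>a. \<forall>u\<in>span C.
     f u = (\<Sum>e\<in>{e. (\<forall>c. c \<notin> C \<longrightarrow> e c = 0) \<and> (\<Sum>c\<in>C. e c) \<le> d}.
              a e * (\<Prod>c\<in>C. representation C u c ^ e c)))"

end

theory Submission
  imports Defs
begin

text \<open>For \<open>u = z + v\<close> with \<open>z\<close> central and \<open>v\<close> in the derived algebra, \<open>ad u = ad v\<close> maps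
  everything into the derived algebra, which is abelian; hence \<open>(ad u)\<^sup>2 = 0\<close> and
  \<open>Ad (exp (t u)) = 1 + t ad u\<close> on \<open>'g\<close>. Differentiating \<open>Q (gh) = Q g + Ad g (Q h)\<close> along the
  one-parameter subgroup gives \<open>d/dt Q (exp (t u)) = Ad (exp (t u)) (\<xi> u)\<close>, a polynomial in \<open>t\<close>
  with coefficients \<open>\<xi> u\<close>, \<open>ad u (\<xi> u)\<close> and \<open>(ad u \<otimes> ad u) (\<xi> u)\<close>.

  The last of these vanishes. Applied to \<open>ad u r\<close>, the operator \<open>ad u \<otimes> ad u\<close> produces a factor
  \<open>(ad u)\<^sup>2\<close> in one of the two slots. The value \<open>R z\<close> is invariant, so that \<open>ad u\<close> can be moved from
  one slot to the other, again producing \<open>(ad u)\<^sup>2\<close>. Finally \<open>R v\<close> lies in the sum of the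
  \<open>(s \<oplus> z) \<and> P\<^sub>l\<close>, and \<open>ad u\<close> is zero on \<open>P\<^sub>l\<close>. Therefore
  \<open>Q (exp u) = \<xi> u + (1/2) ad u (\<xi> u)\<close> (\<open>multiplicative_tensor_E\<close> and
  \<open>normalized_cocycle_quadratic_zero\<close>), and this is a linear plus a quadratic function of \<open>u\<close>
  (\<open>polynomial_linear_plus_quadratic\<close>).

  The analytic point is \<open>d/dt Ad (exp (t u)) x = [u, x]\<close> at \<open>t = 0\<close>, where the bracket is the one of
  left-invariant vector fields (\<open>Ad_E_derivative_0\<close>). Evaluated on a smooth function it is the symmetry
  of second derivatives, which requires the chain rule for smooth maps between manifolds, and
  hence that the composite of two \<open>k\<close> times continuously differentiable maps is again one.\<close>

section \<open>Functions of class \<open>C\<^sup>k\<close> on open sets\<close>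

lemma Ck_on_cong:
  fixes f :: "'a::euclidean_space \<Rightarrow> 'b::real_normed_vector"
  assumes "open S" "\<And>x. x \<in> S \<Longrightarrow> f x = g x"
  shows "Ck_on k S f \<longleftrightarrow> Ck_on k S g"
proof -
  have "Ck_on k S g" if "Ck_on k S f" "\<And>x. x \<in> S \<Longrightarrow> f x = g x" for f g :: "'a \<Rightarrow> 'b"
    using that
  proof (induction k arbitrary: f g)
    case 0
    then show ?case by (simp cong: continuous_on_cong)
  next
    case (Suc k)
    have diff: "g differentiable (at x)" if "x \<in> S" for x
      using Suc.prems that assms(1) unfolding differentiable_def Ck_on.simps
      by (meson has_derivative_transform_within_open)
    have eq: "frechet_derivative f (at x) = frechet_derivative g (at x)" if "x \<in> S" for x
      using frechet_derivative_transform_within_open[of f x S g] Suc.prems that assms(1) by simp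
    have "Ck_on k S (\<lambda>x. frechet_derivative g (at x) v)" for v
      by (rule Suc.IH[of "\<lambda>x. frechet_derivative f (at x) v"]) (use Suc.prems eq in simp_all)
    then show ?case using diff by simp
  qed
  from this[of f g] this[of g f] show ?thesis using assms(2) by auto
qed

lemma Ck_on_subset: "Ck_on k T f \<Longrightarrow> S \<subseteq> T \<Longrightarrow> Ck_on k S f"
  by (induction k arbitrary: f) (auto intro: continuous_on_subset)

lemma Ck_on_local:
  assumes "\<And>x. x \<in> S \<Longrightarrow> \<exists>T. open T \<and> x \<in> T \<and> Ck_on k T f"
  shows "Ck_on k S f"
  using assms
proof (induction k arbitrary: f)
  case 0
  have "isCont f x" if "x \<in> S" for x
    using 0[OF that] by (auto simp: continuous_on_eq_continuous_at)
  then show ?case by (simp add: continuous_at_imp_continuous_on)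
next
  case (Suc k)
  have "Ck_on k S (\<lambda>x. frechet_derivative f (at x) v)" for v
  proof (rule Suc.IH)
    fix x assume "x \<in> S"
    with Suc.prems[OF this] show "\<exists>T. open T \<and> x \<in> T \<and> Ck_on k T (\<lambda>x. frechet_derivative f (at x) v)"
      by auto
  qed
  moreover have "f differentiable (at x)" if "x \<in> S" for x
    using Suc.prems[OF that] by auto
  ultimately show ?case by simp
qed

lemma Ck_on_imp_continuous_on: "Ck_on k S f \<Longrightarrow> continuous_on S f"
  by (cases k)
     (auto intro!: continuous_at_imp_continuous_on simp: differentiable_imp_continuous_within)

lemma Ck_on_Suc_imp: "Ck_on (Suc k) S f \<Longrightarrow> Ck_on k S f"
proof (induction k arbitrary: f)
  case 0
  then show ?case by (metis Ck_on_imp_continuous_on Ck_on.simps(1))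
next
  case (Suc k)
  then show ?case by (metis Ck_on.simps(2))
qed

text \<open>Each closure property of \<open>Ck_on\<close> is proved by induction on \<open>k\<close>, for all functions at once; this rule
  replaces \<open>frechet_derivative\<close>, a choice operator, by the derivative that the differentiation rules
  supply.\<close>

lemma Ck_on_SucI:
  assumes "open S" "\<And>x. x \<in> S \<Longrightarrow> (f has_derivative D x) (at x)"
    and "\<And>v. Ck_on k S (\<lambda>x. D x v)"
  shows "Ck_on (Suc k) S f"
proof -
  have eq: "D x = frechet_derivative f (at x)" if "x \<in> S" for x
    using assms(2)[OF that] by (rule frechet_derivative_at)
  have "Ck_on k S (\<lambda>x. frechet_derivative f (at x) v)" for v
    by (subst Ck_on_cong[OF assms(1), of _ "\<lambda>x. D x v"]) (simp_all add: eq assms(3))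
  then show ?thesis using assms(2) by (auto simp: differentiable_def)
qed

lemma Ck_on_has_derivative:
  "Ck_on (Suc k) S f \<Longrightarrow> x \<in> S \<Longrightarrow> (f has_derivative frechet_derivative f (at x)) (at x)"
  by (simp add: frechet_derivative_works)

lemma Ck_on_const: "open S \<Longrightarrow> Ck_on k S (\<lambda>x. c)"
proof (induction k arbitrary: c)
  case (Suc k)
  then show ?case by (intro Ck_on_SucI[where D = "\<lambda>x v. 0"]) auto
qed auto

lemma Ck_on_bounded_linear:
  assumes "bounded_linear T" "open S"
  shows "Ck_on k S T"
proof (cases k)
  case 0
  then show ?thesis using assms by (simp add: linear_continuous_on)
next
  case (Suc k')
  show ?thesis
    unfolding Suc using assms
    by (intro Ck_on_SucI[where D = "\<lambda>x. T"] Ck_on_const bounded_linear_imp_has_derivative)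
qed

lemma Ck_on_linear_image:
  assumes "bounded_linear T" "open S" "Ck_on k S f"
  shows "Ck_on k S (\<lambda>x. T (f x))"
  using assms(3)
proof (induction k arbitrary: f)
  case 0
  then show ?case using assms(1) by (simp add: bounded_linear.continuous_on)
next
  case (Suc k)
  show ?case
    by (rule Ck_on_SucI[OF assms(2)
          bounded_linear.has_derivative[OF assms(1) Ck_on_has_derivative[OF Suc.prems]]])
       (use Suc in auto)
qed

lemma Ck_on_add:
  assumes "open S" "Ck_on k S f" "Ck_on k S g"
  shows "Ck_on k S (\<lambda>x. f x + g x)"
  using assms(2,3)
proof (induction k arbitrary: f g)
  case 0
  then show ?case by (simp add: continuous_on_add)
next
  case (Suc k)
  show ?case
    by (rule Ck_on_SucI[OF assms(1)
          has_derivative_add[OF Ck_on_has_derivative[OF Suc.prems(1)]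
            Ck_on_has_derivative[OF Suc.prems(2)]]])
       (use Suc in auto)
qed

lemma Ck_on_sum:
  assumes "open S" "\<And>i. i \<in> I \<Longrightarrow> Ck_on k S (f i)"
  shows "Ck_on k S (\<lambda>x. \<Sum>i\<in>I. f i x)"
  using assms(2)
  by (induction I rule: infinite_finite_induct) (auto simp: Ck_on_const Ck_on_add assms(1))

lemma Ck_on_bilinear:
  assumes "bounded_bilinear pr" "open S" "Ck_on k S f" "Ck_on k S g"
  shows "Ck_on k S (\<lambda>x. pr (f x) (g x))"
  using assms(3,4)
proof (induction k arbitrary: f g)
  case 0
  then show ?case using assms(1) by (simp add: bounded_bilinear.continuous_on)
next
  case (Suc k)
  note low = Suc.prems[THEN Ck_on_Suc_imp]
  show ?case
    by (rule Ck_on_SucI[OF assms(2)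
          bounded_bilinear.FDERIV[OF assms(1) Ck_on_has_derivative[OF Suc.prems(1)]
            Ck_on_has_derivative[OF Suc.prems(2)]]])
       (use Suc low in \<open>auto intro!: Ck_on_add assms(2)\<close>)
qed

text \<open>The derivative of a composite is expanded in the standard basis, since only the values of a
  derivative in fixed directions are known to be differentiable again.\<close>

lemma Ck_on_compose:
  fixes f :: "'b::euclidean_space \<Rightarrow> 'c::real_normed_vector" and g :: "'a::euclidean_space \<Rightarrow> 'b"
  assumes "open S" "g ` S \<subseteq> T" "Ck_on k S g" "Ck_on k T f"
  shows "Ck_on k S (\<lambda>x. f (g x))"
  using assms(3,4)
proof (induction k arbitrary: f)
  case 0
  then show ?case using assms(2) by (auto intro: continuous_on_compose2)
next
  case (Suc k)
  let ?Df = "\<lambda>b y. frechet_derivative f (at y) b" and ?Dg = "\<lambda>x. frechet_derivative g (at x)"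
  have der: "((\<lambda>x. f (g x)) has_derivative (\<lambda>v. \<Sum>b\<in>Basis. (?Dg x v \<bullet> b) *\<^sub>R ?Df b (g x))) (at x)"
    if "x \<in> S" for x
  proof -
    have g: "(g has_derivative ?Dg x) (at x)"
      using Suc.prems(1) that by (rule Ck_on_has_derivative)
    have f: "(f has_derivative (\<lambda>b. ?Df b (g x))) (at (g x))"
      using Suc.prems(2) assms(2) that by (auto simp: Ck_on_has_derivative)
    have expand: "?Df w (g x) = (\<Sum>b\<in>Basis. (w \<bullet> b) *\<^sub>R ?Df b (g x))" for w
    proof -
      have "linear (\<lambda>b. ?Df b (g x))" using f by (rule has_derivative_linear)
      then show ?thesis
        by (subst euclidean_representation[of w, symmetric]) (simp add: linear_sum linear_scale)
    qed
    show ?thesis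
      using diff_chain_at[OF g f] unfolding o_def by (subst expand[symmetric])
  qed
  have "Ck_on k S (\<lambda>x. (?Dg x v \<bullet> b) *\<^sub>R ?Df b (g x))" for v b
  proof (rule Ck_on_bilinear[OF bounded_bilinear_scaleR assms(1)])
    show "Ck_on k S (\<lambda>x. ?Dg x v \<bullet> b)"
      using Suc.prems by (intro Ck_on_linear_image[OF bounded_linear_inner_left assms(1)]) auto
    show "Ck_on k S (\<lambda>x. ?Df b (g x))"
      by (rule Suc.IH[OF Ck_on_Suc_imp[OF Suc.prems(1)]]) (use Suc.prems(2) in simp)
  qed
  then show ?case
    by (intro Ck_on_SucI[OF assms(1) der] Ck_on_sum assms(1))
qed

lemma Ck_on_Pair:
  fixes f :: "'a::euclidean_space \<Rightarrow> 'b::real_normed_vector" and g :: "'a \<Rightarrow> 'c::real_normed_vector"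
  assumes "open S" "Ck_on k S f" "Ck_on k S g"
  shows "Ck_on k S (\<lambda>x. (f x, g x))"
proof -
  have "bounded_linear (\<lambda>y::'b. (y, 0::'c))" "bounded_linear (\<lambda>y::'c. (0::'b, y))"
    by (intro bounded_linear_Pair bounded_linear_ident bounded_linear_zero)+
  from Ck_on_add[OF assms(1) Ck_on_linear_image[OF this(1) assms(1,2)]
      Ck_on_linear_image[OF this(2) assms(1,3)]]
  show ?thesis by simp
qed

text \<open>Integrating the mixed derivative over a segment in the direction \<open>w\<close> recovers the difference of
  the derivatives in the direction \<open>v\<close>, by differentiating under the integral; the symmetry
  is the fundamental theorem of calculus.\<close>

lemma frechet_derivative_symmetric:
  fixes F :: "'a::euclidean_space \<Rightarrow> real"
  assumes "Ck_on 2 UNIV F"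
  shows "frechet_derivative (\<lambda>y. frechet_derivative F (at y) v) (at x) w =
    frechet_derivative (\<lambda>y. frechet_derivative F (at y) w) (at x) v"
proof -
  define D where "D v y = frechet_derivative F (at y) v" for v y
  define H where "H y = frechet_derivative (D w) (at y) v" for y
  have Ck: "Ck_on (Suc (Suc 0)) UNIV F" using assms by (simp add: numeral_2_eq_2)
  have FD: "(F has_derivative (\<lambda>v. D v y)) (at y)" for y
    using Ck_on_has_derivative[OF Ck, of y] by (simp add: D_def)
  have D1: "Ck_on (Suc 0) UNIV (D v)" for v
    using Ck unfolding D_def by simp
  have DD: "(D v has_derivative frechet_derivative (D v) (at y)) (at y)" for v y
    using Ck_on_has_derivative[OF D1] by simp
  have contD: "continuous_on T (D v)" for v T
    using Ck_on_imp_continuous_on[OF D1] by (rule continuous_on_subset) simp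
  have contH: "continuous_on T H" for T
    using D1[of w] unfolding H_def by (auto intro: continuous_on_subset)
  have line: "((\<lambda>a. g (y + a *\<^sub>R v)) has_vector_derivative g' v) (at a within T)"
    if "(g has_derivative g') (at (y + a *\<^sub>R v))" for g :: "'a \<Rightarrow> real" and g' y a v T
  proof -
    have "((\<lambda>a. y + a *\<^sub>R v) has_derivative (\<lambda>h. h *\<^sub>R v)) (at a within T)"
      by (auto intro!: derivative_eq_intros)
    from has_derivative_compose[OF this that] show ?thesis
      using has_derivative_linear[OF that] by (simp add: has_vector_derivative_def linear_scale)
  qed
  \<comment> \<open>used for the shifted segments starting at \<open>y = x + a v\<close>, and then differentiated in \<open>a\<close>\<close>
  have ftc: "F (y + b *\<^sub>R w) - F y = integral {0..b} (\<lambda>\<beta>. D w (y + \<beta> *\<^sub>R w))" if "0 \<le> b" for b y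
    using fundamental_theorem_of_calculus[OF that line[OF FD, of y w]]
    by (simp add: integral_unique)
  have diffD: "D v (x + b *\<^sub>R w) - D v x = integral {0..b} (\<lambda>\<beta>. H (x + \<beta> *\<^sub>R w))" if "0 \<le> b" for b
  proof -
    have "((\<lambda>a. integral (cbox 0 b) (\<lambda>\<beta>. D w (x + a *\<^sub>R v + \<beta> *\<^sub>R w))) has_vector_derivative
      integral (cbox 0 b) (\<lambda>\<beta>. H (x + 0 *\<^sub>R v + \<beta> *\<^sub>R w))) (at 0 within UNIV)"
    proof (rule leibniz_rule_vector_derivative)
      show "((\<lambda>a. D w (x + a *\<^sub>R v + \<beta> *\<^sub>R w)) has_vector_derivative H (x + a *\<^sub>R v + \<beta> *\<^sub>R w)) (at a within UNIV)"
        for a \<beta>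
        using line[OF DD[of w "x + \<beta> *\<^sub>R w + a *\<^sub>R v"]] by (simp add: H_def add_ac)
      show "(\<lambda>\<beta>. D w (x + a *\<^sub>R v + \<beta> *\<^sub>R w)) integrable_on cbox 0 b" for a
        by (intro integrable_continuous continuous_on_compose2[OF contD[of UNIV]] continuous_intros) auto
      show "continuous_on (UNIV \<times> cbox 0 b) (\<lambda>(a, \<beta>). H (x + a *\<^sub>R v + \<beta> *\<^sub>R w))"
        unfolding split_beta
        by (intro continuous_on_compose2[OF contH[of UNIV]] continuous_intros) auto
    qed auto
    moreover have "integral (cbox 0 b) (\<lambda>\<beta>. D w (x + a *\<^sub>R v + \<beta> *\<^sub>R w)) =
        F (x + b *\<^sub>R w + a *\<^sub>R v) - F (x + a *\<^sub>R v)" for a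
      using ftc[OF that, of "x + a *\<^sub>R v"] by (simp add: add_ac)
    ultimately have 1: "((\<lambda>a. F (x + b *\<^sub>R w + a *\<^sub>R v) - F (x + a *\<^sub>R v)) has_vector_derivative
        integral {0..b} (\<lambda>\<beta>. H (x + \<beta> *\<^sub>R w))) (at 0)"
      by simp
    have 2: "((\<lambda>a. F (x + b *\<^sub>R w + a *\<^sub>R v) - F (x + a *\<^sub>R v)) has_vector_derivative
        D v (x + b *\<^sub>R w) - D v x) (at 0)"
      using line[OF FD[of "x + b *\<^sub>R w + 0 *\<^sub>R v"]] line[OF FD[of "x + 0 *\<^sub>R v"]]
      by (intro has_vector_derivative_diff) auto
    show ?thesis using vector_derivative_unique_at[OF 2 1] .
  qed
  have "((\<lambda>b. integral {0..b} (\<lambda>\<beta>. H (x + \<beta> *\<^sub>R w))) has_vector_derivative H (x + 0 *\<^sub>R w)) (at 0 within {0..1})"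
    by (rule integral_has_vector_derivative)
       (auto intro!: continuous_on_compose2[OF contH[of UNIV]] continuous_intros)
  then have A: "((\<lambda>b. D v (x + b *\<^sub>R w) - D v x) has_vector_derivative H x) (at 0 within {0..1})"
    by (subst has_vector_derivative_cong_ev[where g = "\<lambda>b. integral {0..b} (\<lambda>\<beta>. H (x + \<beta> *\<^sub>R w))"])
       (auto simp: diffD)
  have B: "((\<lambda>b. D v (x + b *\<^sub>R w) - D v x) has_vector_derivative frechet_derivative (D v) (at x) w) (at 0 within {0..1})"
    using has_vector_derivative_diff[OF line[OF DD[of v "x + 0 *\<^sub>R w"]] has_vector_derivative_const] by simp
  have "at (0::real) within {0..1} \<noteq> bot"
    by (simp add: trivial_limit_within islimpt_Icc)
  then have "H x = frechet_derivative (D v) (at x) w"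
    using A B by (rule vector_derivative_unique_within)
  then show ?thesis by (simp add: H_def D_def [abs_def])
qed

section \<open>Smooth maps between manifolds\<close>

lemma smooth_on_subset: "smooth_on T f \<Longrightarrow> S \<subseteq> T \<Longrightarrow> smooth_on S f"
  using Ck_on_subset unfolding smooth_on_def by blast

lemma smooth_on_local:
  assumes "\<And>x. x \<in> S \<Longrightarrow> \<exists>T. open T \<and> x \<in> T \<and> smooth_on T f"
  shows "smooth_on S f"
  unfolding smooth_on_def by (intro allI Ck_on_local) (use assms smooth_on_def in blast)

lemma smooth_on_compose:
  fixes f :: "'b::euclidean_space \<Rightarrow> 'c::real_normed_vector" and g :: "'a::euclidean_space \<Rightarrow> 'b"
  assumes "open S" "g ` S \<subseteq> T" "smooth_on S g" "smooth_on T f"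
    and "\<And>x. x \<in> S \<Longrightarrow> h x = f (g x)"
  shows "smooth_on S h"
  using assms Ck_on_compose[OF assms(1,2)] Ck_on_cong[OF assms(1), of h "\<lambda>x. f (g x)"]
  unfolding smooth_on_def by blast

lemma smooth_on_Pair:
  "open S \<Longrightarrow> smooth_on S f \<Longrightarrow> smooth_on S g \<Longrightarrow> smooth_on S (\<lambda>x. (f x, g x))"
  unfolding smooth_on_def by (simp add: Ck_on_Pair)

lemma smooth_on_const: "open S \<Longrightarrow> smooth_on S (\<lambda>x. c)"
  unfolding smooth_on_def by (simp add: Ck_on_const)

lemma smooth_on_bounded_linear: "open S \<Longrightarrow> bounded_linear T \<Longrightarrow> smooth_on S T"
  unfolding smooth_on_def by (simp add: Ck_on_bounded_linear)

text \<open>The property of the middle and the target manifold on which the chain rule rests. It passes to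
  products without any computation of transition maps, so that \<open>G \<times> G\<close> can be a middle manifold.\<close>

definition open_chart_cover :: "('a::topological_space, 'e) chart set \<Rightarrow> bool" where
  "open_chart_cover A \<longleftrightarrow>
     (\<forall>p. \<exists>U \<phi>. (U, \<phi>) \<in> A \<and> p \<in> U) \<and> (\<forall>U \<phi>. (U, \<phi>) \<in> A \<longrightarrow> open U \<and> inj_on \<phi> U)"

lemma smooth_atlas_charts:
  assumes "smooth_atlas A" "(U, \<phi>) \<in> A"
  shows "open U" "open (\<phi> ` U)" "inj_on \<phi> U" "continuous_on (\<phi> ` U) (inv_into U \<phi>)"
    "continuous_on U \<phi>"
proof -
  have *: "open U" "open (\<phi> ` U)" "homeomorphism U (\<phi> ` U) \<phi> (inv_into U \<phi>)"
    using assms unfolding smooth_atlas_def by blast+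
  then show "open U" "open (\<phi> ` U)" by auto
  show "inj_on \<phi> U"
    using *(3) unfolding homeomorphism_def by (metis inj_on_def)
  show "continuous_on (\<phi> ` U) (inv_into U \<phi>)" "continuous_on U \<phi>"
    using *(3) unfolding homeomorphism_def by auto
qed

lemma smooth_atlas_open_chart_cover: "smooth_atlas A \<Longrightarrow> open_chart_cover A"
proof -
  assume A: "smooth_atlas A"
  have "p \<in> (\<Union>(U, \<phi>)\<in>A. U)" for p using A unfolding smooth_atlas_def by simp
  then show ?thesis
    using smooth_atlas_charts(1,3)[OF A] unfolding open_chart_cover_def by fast
qed

lemma smooth_atlas_open_image:
  assumes "smooth_atlas A" "(U, \<phi>) \<in> A" "open W"
  shows "open (\<phi> ` (U \<inter> W))"
proof -
  have "\<phi> ` (U \<inter> W) = \<phi> ` U \<inter> inv_into U \<phi> -` W"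
    using smooth_atlas_charts(3)[OF assms(1,2)] by (auto simp: inv_into_f_f)
  then show ?thesis
    using continuous_open_preimage[OF smooth_atlas_charts(4,2)[OF assms(1,2)] assms(3)] by simp
qed

lemma open_chart_cover_prod:
  assumes "open_chart_cover A" "open_chart_cover B"
  shows "open_chart_cover (prod_atlas A B)"
  unfolding open_chart_cover_def
proof safe
  fix p q
  obtain U \<phi> V \<psi> where "(U, \<phi>) \<in> A" "p \<in> U" "(V, \<psi>) \<in> B" "q \<in> V"
    using assms unfolding open_chart_cover_def by blast
  then show "\<exists>W \<theta>. (W, \<theta>) \<in> prod_atlas A B \<and> (p, q) \<in> W"
    unfolding prod_atlas_def by blast
next
  fix W \<theta> assume "(W, \<theta>) \<in> prod_atlas A B"
  then obtain U \<phi> V \<psi> where "W = U \<times> V" "\<theta> = map_prod \<phi> \<psi>" "(U, \<phi>) \<in> A" "(V, \<psi>) \<in> B"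
    unfolding prod_atlas_def by blast
  moreover from this(3,4) have "open U" "inj_on \<phi> U" "open V" "inj_on \<psi> V"
    using assms unfolding open_chart_cover_def by blast+
  ultimately show "open W" "inj_on \<theta> W"
    by (auto simp: open_Times map_prod_inj_on)
qed

lemma smooth_atlas_vector_atlas: "smooth_atlas (vector_atlas :: ('e::euclidean_space, 'e) chart set)"
  by (auto simp: smooth_atlas_def vector_atlas_def homeomorphism_def inv_id[unfolded id_def] id_def
      o_def intro!: smooth_on_bounded_linear)

lemma smooth_map_continuous: "smooth_map A B F \<Longrightarrow> open V \<Longrightarrow> open (F -` V)"
  unfolding smooth_map_def by (auto intro: open_vimage)

lemma smooth_map_charts:
  "smooth_map A B F \<Longrightarrow> (U, \<phi>) \<in> A \<Longrightarrow> (V, \<psi>) \<in> B \<Longrightarrow>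
    smooth_on (\<phi> ` (U \<inter> F -` V)) (\<psi> \<circ> F \<circ> inv_into U \<phi>)"
  unfolding smooth_map_def by blast

text \<open>The chart of the middle manifold has to be chosen at each point, so that the coordinate
  expression of the composite factors through the middle chart only locally.\<close>

lemma smooth_map_compose:
  assumes "smooth_atlas A" "open_chart_cover B" "open_chart_cover C"
    and F: "smooth_map A B F" and H: "smooth_map B C H"
  shows "smooth_map A C (\<lambda>p. H (F p))"
  unfolding smooth_map_def
proof safe
  show "continuous_on UNIV (\<lambda>p. H (F p))"
    using F H unfolding smooth_map_def by (auto intro: continuous_on_compose2)
next
  fix U \<phi> W \<theta> assume U: "(U, \<phi>) \<in> A" and W: "(W, \<theta>) \<in> C"
  have oW: "open W" using assms(3) W unfolding open_chart_cover_def by blast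
  show "smooth_on (\<phi> ` (U \<inter> (\<lambda>p. H (F p)) -` W)) (\<theta> \<circ> (\<lambda>p. H (F p)) \<circ> inv_into U \<phi>)"
  proof (rule smooth_on_local)
    fix x assume "x \<in> \<phi> ` (U \<inter> (\<lambda>p. H (F p)) -` W)"
    then obtain p where p: "x = \<phi> p" "p \<in> U" "H (F p) \<in> W" by auto
    obtain V \<psi> where V: "(V, \<psi>) \<in> B" "F p \<in> V" "open V" "inj_on \<psi> V"
      using assms(2) unfolding open_chart_cover_def by fast
    define T where "T = \<phi> ` (U \<inter> F -` (V \<inter> H -` W))"
    have oT: "open T"
      unfolding T_def
      by (intro smooth_atlas_open_image[OF assms(1) U] smooth_map_continuous[OF F] open_Int V(3)
          smooth_map_continuous[OF H] oW)
    have inv: "inv_into U \<phi> (\<phi> q) = q" if "q \<in> U" for q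
      using smooth_atlas_charts(3)[OF assms(1) U] that by simp
    have 1: "smooth_on T (\<psi> \<circ> F \<circ> inv_into U \<phi>)"
      unfolding T_def by (rule smooth_on_subset[OF smooth_map_charts[OF F U V(1)]]) auto
    have 2: "smooth_on (\<psi> ` (V \<inter> H -` W)) (\<theta> \<circ> H \<circ> inv_into V \<psi>)"
      by (rule smooth_map_charts[OF H V(1) W])
    have "smooth_on T (\<theta> \<circ> (\<lambda>p. H (F p)) \<circ> inv_into U \<phi>)"
      by (rule smooth_on_compose[OF oT _ 1 2]) (auto simp: T_def inv V(4))
    moreover have "x \<in> T" using p V(2) by (auto simp: T_def)
    ultimately show "\<exists>T. open T \<and> x \<in> T \<and> smooth_on T (\<theta> \<circ> (\<lambda>p. H (F p)) \<circ> inv_into U \<phi>)"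
      using oT by blast
  qed
qed

lemma smooth_map_Pair:
  assumes "smooth_atlas A" "open_chart_cover B" "open_chart_cover C"
    and F: "smooth_map A B F" and H: "smooth_map A C H"
  shows "smooth_map A (prod_atlas B C) (\<lambda>p. (F p, H p))"
  unfolding smooth_map_def
proof safe
  show "continuous_on UNIV (\<lambda>p. (F p, H p))"
    using F H unfolding smooth_map_def by (auto intro: continuous_on_Pair)
next
  fix U \<phi> Y \<eta> assume U: "(U, \<phi>) \<in> A" and "(Y, \<eta>) \<in> prod_atlas B C"
  then obtain V \<psi> W \<theta> where Y: "Y = V \<times> W" "\<eta> = map_prod \<psi> \<theta>" and V: "(V, \<psi>) \<in> B" and W: "(W, \<theta>) \<in> C"
    unfolding prod_atlas_def by blast
  have oVW: "open V" "open W" using assms(2,3) V W unfolding open_chart_cover_def by blast+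
  define S where "S = \<phi> ` (U \<inter> (F -` V \<inter> H -` W))"
  have "open S"
    unfolding S_def
    by (intro smooth_atlas_open_image[OF assms(1) U] open_Int oVW
        smooth_map_continuous[OF F] smooth_map_continuous[OF H])
  moreover have "smooth_on S (\<psi> \<circ> F \<circ> inv_into U \<phi>)"
    unfolding S_def by (rule smooth_on_subset[OF smooth_map_charts[OF F U V]]) auto
  moreover have "smooth_on S (\<theta> \<circ> H \<circ> inv_into U \<phi>)"
    unfolding S_def by (rule smooth_on_subset[OF smooth_map_charts[OF H U W]]) auto
  ultimately have "smooth_on S (\<lambda>x. ((\<psi> \<circ> F \<circ> inv_into U \<phi>) x, (\<theta> \<circ> H \<circ> inv_into U \<phi>) x))"
    by (rule smooth_on_Pair)
  moreover have "U \<inter> (\<lambda>p. (F p, H p)) -` Y = U \<inter> (F -` V \<inter> H -` W)"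
    by (auto simp: Y)
  ultimately show "smooth_on (\<phi> ` (U \<inter> (\<lambda>p. (F p, H p)) -` Y)) (\<eta> \<circ> (\<lambda>p. (F p, H p)) \<circ> inv_into U \<phi>)"
    by (simp add: S_def Y o_def)
qed

lemma smooth_map_ident: "smooth_atlas A \<Longrightarrow> smooth_map A A (\<lambda>p. p)"
  unfolding smooth_map_def smooth_atlas_def by (auto simp: o_def)

lemma smooth_map_const:
  assumes "smooth_atlas A"
  shows "smooth_map A B (\<lambda>p. c)"
  unfolding smooth_map_def
proof safe
  fix U \<phi> V and \<psi> :: "'c \<Rightarrow> 'd" assume "(U, \<phi>) \<in> A"
  then have "open (\<phi> ` U)" by (rule smooth_atlas_charts(2)[OF assms])
  then show "smooth_on (\<phi> ` (U \<inter> (\<lambda>p. c) -` V)) (\<psi> \<circ> (\<lambda>p. c) \<circ> inv_into U \<phi>)"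
    by (cases "c \<in> V") (simp_all add: o_def smooth_on_const)
qed simp

text \<open>Smooth functions with values in a Euclidean space are smooth maps, so that one chain rule
  serves both.\<close>

lemma smooth_fun_iff_smooth_map:
  fixes f :: "'a::topological_space \<Rightarrow> 'b::euclidean_space"
  assumes "smooth_atlas A"
  shows "smooth_fun A f \<longleftrightarrow> smooth_map A vector_atlas f"
proof
  assume f: "smooth_fun A f"
  have "continuous_on U f" if U: "(U, \<phi>) \<in> A" for U \<phi>
  proof -
    note ch = smooth_atlas_charts[OF assms U]
    have "smooth_on (\<phi> ` U) (f \<circ> inv_into U \<phi>)"
      using f U unfolding smooth_fun_def by blast
    then have "Ck_on 0 (\<phi> ` U) (f \<circ> inv_into U \<phi>)" unfolding smooth_on_def by blast
    then have "continuous_on (\<phi> ` U) (f \<circ> inv_into U \<phi>)" by simp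
    from continuous_on_compose[OF ch(5) this] show ?thesis
      by (rule continuous_on_eq) (use ch(3) in auto)
  qed
  then have "continuous_on (\<Union>(fst ` A)) f"
    using smooth_atlas_charts(1)[OF assms] by (intro continuous_on_open_Union) auto
  moreover have "\<Union>(fst ` A) = UNIV"
    using assms unfolding smooth_atlas_def by (auto simp: split_beta)
  ultimately have "continuous_on UNIV f" by simp
  then show "smooth_map A vector_atlas f"
    using f unfolding smooth_map_def smooth_fun_def vector_atlas_def
    by auto
next
  assume "smooth_map A vector_atlas f"
  then show "smooth_fun A f"
    unfolding smooth_map_def smooth_fun_def vector_atlas_def by auto
qed

lemma smooth_fun_compose:
  fixes f :: "'b::topological_space \<Rightarrow> 'c::euclidean_space"
  assumes "smooth_atlas A" "smooth_atlas B" "smooth_map A B F" "smooth_fun B f"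
  shows "smooth_fun A (\<lambda>p. f (F p))"
  using assms(1,2,4) smooth_map_compose[OF assms(1) _ _ assms(3), of vector_atlas f]
  by (simp add: smooth_fun_iff_smooth_map smooth_atlas_open_chart_cover smooth_atlas_vector_atlas)

lemma smooth_fun_vector_atlas: "smooth_fun vector_atlas f \<longleftrightarrow> smooth_on UNIV f"
  by (simp add: smooth_fun_def vector_atlas_def)

lemma smooth_map_bounded_linear:
  assumes "bounded_linear T"
  shows "smooth_map vector_atlas vector_atlas T"
  using assms
  by (simp add: smooth_fun_iff_smooth_map[symmetric] smooth_atlas_vector_atlas
      smooth_fun_vector_atlas smooth_on_bounded_linear)

lemma smooth_fun_linear_image:
  assumes "smooth_atlas A" "bounded_linear T" "smooth_fun A f"
  shows "smooth_fun A (\<lambda>p. T (f p))"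
  unfolding smooth_fun_def
proof safe
  fix U \<phi> assume "(U, \<phi>) \<in> A"
  then show "smooth_on (\<phi> ` U) ((\<lambda>p. T (f p)) \<circ> inv_into U \<phi>)"
    using assms smooth_atlas_charts(2)[OF assms(1)] Ck_on_linear_image[OF assms(2)]
    unfolding smooth_fun_def smooth_on_def o_def by blast
qed

section \<open>Left-invariant fields and the adjoint representation\<close>

lemma has_real_derivative_line:
  fixes F :: "'a::real_normed_vector \<Rightarrow> real"
  assumes "F differentiable (at x)"
  shows "((\<lambda>t. F (x + t *\<^sub>R v)) has_real_derivative frechet_derivative F (at x) v) (at 0)"
proof -
  have F: "(F has_derivative frechet_derivative F (at x)) (at (x + 0 *\<^sub>R v))"
    using assms by (simp add: frechet_derivative_works)
  have "((\<lambda>t::real. x + t *\<^sub>R v) has_derivative (\<lambda>h. h *\<^sub>R v)) (at 0)"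
    by (auto intro!: derivative_eq_intros)
  from has_derivative_compose[OF this F] show ?thesis
    using has_derivative_linear[OF F]
    by (simp add: has_field_derivative_def linear_scale mult_commute_abs)
qed

lemma has_real_derivative_translate:
  fixes f :: "real \<Rightarrow> real"
  assumes "((\<lambda>h. f (t + h)) has_real_derivative d) (at 0)"
  shows "(f has_real_derivative d) (at t)"
  using assms DERIV_shift[of f d 0 t] by (simp add: add.commute)

lemma linear_of_constant_derivative:
  fixes f :: "real \<Rightarrow> real"
  assumes "\<And>t. (f has_real_derivative d) (at t)"
  shows "f t = f 0 + t * d"
proof -
  have "((\<lambda>t. f t - t * d) has_real_derivative 0) (at t)" for t
    using assms by (auto intro!: derivative_eq_intros)
  then have "f t - t * d = f 0 - 0 * d"
    using DERIV_isconst_all[of "\<lambda>t. f t - t * d" t 0] by simp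
  then show ?thesis by simp
qed

locale lie_group_with_algebra =
  fixes G :: "('a::{t2_space, second_countable_topology}) monoid"
    and A :: "('a, 'e::euclidean_space) chart set"
    and br :: "'g::euclidean_space \<Rightarrow> 'g \<Rightarrow> 'g"
    and L :: "'g \<Rightarrow> 'a vfield"
  assumes lie_group: "lie_group G A"
    and lie_algebra: "lie_algebra_of G A br L"
begin

sublocale group G
  using lie_group unfolding lie_group_def by blast

lemma in_carrier [simp]: "g \<in> carrier G"
  using lie_group unfolding lie_group_def by simp

lemma atlas: "smooth_atlas A"
  using lie_group unfolding lie_group_def by blast

lemma smooth_map_mult:
  assumes "smooth_atlas S" "smooth_map S A F" "smooth_map S A H"
  shows "smooth_map S A (\<lambda>p. F p \<otimes>\<^bsub>G\<^esub> H p)"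
proof -
  have "smooth_map (prod_atlas A A) A (\<lambda>(g, h). g \<otimes>\<^bsub>G\<^esub> h)"
    using lie_group unfolding lie_group_def by blast
  moreover note cov = smooth_atlas_open_chart_cover[OF atlas]
  ultimately show ?thesis
    using smooth_map_compose[OF assms(1) open_chart_cover_prod[OF cov cov] cov
        smooth_map_Pair[OF assms(1) cov cov assms(2,3)], of "\<lambda>(g, h). g \<otimes>\<^bsub>G\<^esub> h"] by simp
qed

lemma smooth_fun_translate:
  fixes f :: "'a \<Rightarrow> 'b::euclidean_space"
  assumes "smooth_fun A f"
  shows "smooth_fun A (\<lambda>h. f (g \<otimes>\<^bsub>G\<^esub> h))" "smooth_fun A (\<lambda>h. f (h \<otimes>\<^bsub>G\<^esub> g))"
  by (intro smooth_fun_compose[OF atlas atlas _ assms] smooth_map_mult smooth_map_const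
      smooth_map_ident atlas)+

lemma vector_field_L: "vector_field A (L x)" and left_invariant_L: "left_invariant G A (L x)"
  using lie_algebra unfolding lie_algebra_of_def bij_betw_def by blast+

lemma L_linear: "L (a *\<^sub>R x + b *\<^sub>R y) f p = a * L x f p + b * L y f p"
  using lie_algebra unfolding lie_algebra_of_def by blast

lemma L_add: "L (x + y) f p = L x f p + L y f p"
  using L_linear[of 1 x 1 y] by simp

lemma L_scale: "L (a *\<^sub>R x) f p = a * L x f p"
  using L_linear[of a x 0 x] by simp

lemma L_zero: "L 0 f p = 0"
  using L_scale[of 0 0] by simp

lemma L_bracket: "L (br x y) f p = L x (L y f) p - L y (L x f) p"
  using lie_algebra unfolding lie_algebra_of_def vf_bracket_def by metis

lemma L_smooth: "smooth_fun A f \<Longrightarrow> smooth_fun A (L x f)"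
  using vector_field_L[of x] unfolding vector_field_def by blast

lemma L_not_smooth: "\<not> smooth_fun A f \<Longrightarrow> L x f = (\<lambda>p. 0)"
  using vector_field_L[of x] unfolding vector_field_def by blast

lemma L_left_translate: "smooth_fun A f \<Longrightarrow> L x (\<lambda>h. f (g \<otimes>\<^bsub>G\<^esub> h)) p = L x f (g \<otimes>\<^bsub>G\<^esub> p)"
  using left_invariant_L[of x] unfolding left_invariant_def by metis

text \<open>A left-invariant field is determined by its value at one point, since left translations are
  transitive; on non-smooth functions all vector fields are zero.\<close>

lemma L_eqI:
  assumes "\<And>f. smooth_fun A f \<Longrightarrow> L x f p = L y f p"
  shows "x = y"
proof -
  have "L x f q = L y f q" if "smooth_fun A f" for f q
  proof -
    let ?g = "q \<otimes>\<^bsub>G\<^esub> inv\<^bsub>G\<^esub> p"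
    have q: "q = ?g \<otimes>\<^bsub>G\<^esub> p" by (simp add: m_assoc)
    have "L x f (?g \<otimes>\<^bsub>G\<^esub> p) = L y f (?g \<otimes>\<^bsub>G\<^esub> p)"
      using assms[OF smooth_fun_translate(1)[OF that, of ?g]] that by (simp add: L_left_translate)
    then show ?thesis by (simp flip: q)
  qed
  then have "L x = L y"
    by (metis L_not_smooth ext)
  then show ?thesis
    using lie_algebra unfolding lie_algebra_of_def bij_betw_def by (meson UNIV_I inj_onD)
qed

text \<open>Right translation by \<open>g\<close> carries left-invariant fields to left-invariant fields; the vector
  field so obtained from \<open>L x\<close> witnesses the existence of \<open>Ad g x\<close>, and gives a
  description of \<open>Ad g x\<close> that holds at every point, not only at the identity.\<close>

lemma Ad_L:
  assumes f: "smooth_fun A f"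
  shows "L (Ad G A L g x) f p = L x (\<lambda>h. f (h \<otimes>\<^bsub>G\<^esub> inv\<^bsub>G\<^esub> g)) (p \<otimes>\<^bsub>G\<^esub> g)"
proof -
  define r where "r f = (\<lambda>h. f (h \<otimes>\<^bsub>G\<^esub> inv\<^bsub>G\<^esub> g))" for f :: "'a \<Rightarrow> real"
  define Y where "Y f p = L x (r f) (p \<otimes>\<^bsub>G\<^esub> g)" for f p
  have r: "smooth_fun A (r f)" if "smooth_fun A f" for f
    unfolding r_def using that by (rule smooth_fun_translate(2))
  have r': "smooth_fun A f" if "smooth_fun A (r f)" for f
    using smooth_fun_translate(2)[OF that, of g] by (simp add: r_def m_assoc)
  have "vector_field A Y"
  proof -
    note vf = vector_field_L[of x, unfolded vector_field_def]
    have "smooth_fun A (Y f)" if "smooth_fun A f" for f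
      unfolding Y_def by (rule smooth_fun_translate(2)[OF L_smooth[OF r[OF that]]])
    moreover have "Y (\<lambda>p. a * f p + b * h p) = (\<lambda>p. a * Y f p + b * Y h p)"
      if "smooth_fun A f" "smooth_fun A h" for f h a b
    proof -
      have "L x (\<lambda>p. a * r f p + b * r h p) = (\<lambda>p. a * L x (r f) p + b * L x (r h) p)"
        using vf r[OF that(1)] r[OF that(2)] by blast
      then show ?thesis unfolding Y_def fun_eq_iff by (simp add: r_def)
    qed
    moreover have "Y (\<lambda>p. f p * h p) = (\<lambda>p. f p * Y h p + h p * Y f p)"
      if "smooth_fun A f" "smooth_fun A h" for f h
    proof -
      have "L x (\<lambda>p. r f p * r h p) = (\<lambda>p. r f p * L x (r h) p + r h p * L x (r f) p)"
        using vf r[OF that(1)] r[OF that(2)] by blast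
      then show ?thesis unfolding Y_def fun_eq_iff by (simp add: r_def m_assoc)
    qed
    moreover have "Y f = (\<lambda>p. 0)" if "\<not> smooth_fun A f" for f
      unfolding Y_def using that r' L_not_smooth by metis
    ultimately show ?thesis unfolding vector_field_def by blast
  qed
  moreover have "left_invariant G A Y"
    unfolding left_invariant_def
  proof (intro allI impI ext)
    fix k h and f :: "'a \<Rightarrow> real" assume "smooth_fun A f"
    from L_left_translate[OF r[OF this], of x k "h \<otimes>\<^bsub>G\<^esub> g"]
    show "Y (\<lambda>h. f (k \<otimes>\<^bsub>G\<^esub> h)) h = Y f (k \<otimes>\<^bsub>G\<^esub> h)"
      by (simp add: Y_def r_def m_assoc)
  qed
  ultimately have "Y \<in> range L"
    using lie_algebra unfolding lie_algebra_of_def bij_betw_def by blast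
  then obtain y where y: "Y = L y" by blast
  have at_one: "L x (\<lambda>h. f (g \<otimes>\<^bsub>G\<^esub> h \<otimes>\<^bsub>G\<^esub> inv\<^bsub>G\<^esub> g)) \<one>\<^bsub>G\<^esub> = L y f \<one>\<^bsub>G\<^esub>" if "smooth_fun A f" for f
    using L_left_translate[OF r[OF that], of x g "\<one>\<^bsub>G\<^esub>"] by (simp add: y[symmetric] Y_def r_def)
  have "Ad G A L g x = y"
    unfolding Ad_def
  proof (rule the_equality)
    show "\<forall>f. smooth_fun A f \<longrightarrow> L y f \<one>\<^bsub>G\<^esub> = L x (\<lambda>h. f (g \<otimes>\<^bsub>G\<^esub> h \<otimes>\<^bsub>G\<^esub> inv\<^bsub>G\<^esub> g)) \<one>\<^bsub>G\<^esub>"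
      using at_one by simp
    show "y' = y" if "\<forall>f. smooth_fun A f \<longrightarrow>
        L y' f \<one>\<^bsub>G\<^esub> = L x (\<lambda>h. f (g \<otimes>\<^bsub>G\<^esub> h \<otimes>\<^bsub>G\<^esub> inv\<^bsub>G\<^esub> g)) \<one>\<^bsub>G\<^esub>" for y'
      by (rule L_eqI[of _ "\<one>\<^bsub>G\<^esub>"]) (use that at_one in simp)
  qed
  then show ?thesis by (simp add: y[symmetric] Y_def r_def)
qed

end

locale lie_group_with_exp = lie_group_with_algebra G A br L
  for G :: "('a::{t2_space, second_countable_topology}) monoid"
    and A :: "('a, 'e::euclidean_space) chart set"
    and br :: "'g::euclidean_space \<Rightarrow> 'g \<Rightarrow> 'g"
    and L :: "'g \<Rightarrow> 'a vfield" +
  fixes E :: "'g \<Rightarrow> 'a"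
  assumes exp_map: "exponential_map G A L E"
begin

lemma E_add: "E ((t + t') *\<^sub>R x) = E (t *\<^sub>R x) \<otimes>\<^bsub>G\<^esub> E (t' *\<^sub>R x)"
  using exp_map unfolding exponential_map_def one_param_subgroup_def by blast

lemma E_0: "E 0 = \<one>\<^bsub>G\<^esub>"
  using E_add[of 0 0 0] l_cancel_one[of "E 0" "E 0"] by simp

lemma inv_E: "inv\<^bsub>G\<^esub> (E (t *\<^sub>R x)) = E ((- t) *\<^sub>R x)"
  by (rule inv_equality) (use E_add[of "- t" t x] in \<open>simp_all add: E_0\<close>)

lemma smooth_map_E:
  assumes "bounded_linear T"
  shows "smooth_map vector_atlas A (\<lambda>y. E (T y *\<^sub>R x))"
proof -
  have "smooth_map vector_atlas A (\<lambda>t. E (t *\<^sub>R x))"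
    using exp_map unfolding exponential_map_def one_param_subgroup_def by blast
  then show ?thesis
    by (intro smooth_map_compose[OF smooth_atlas_vector_atlas _ _ smooth_map_bounded_linear[OF assms]]
        smooth_atlas_open_chart_cover atlas smooth_atlas_vector_atlas)
qed

lemma L_derivative:
  assumes "smooth_fun A f"
  shows "((\<lambda>t. f (p \<otimes>\<^bsub>G\<^esub> E (t *\<^sub>R x))) has_real_derivative L x f p) (at 0)"
proof -
  have "((\<lambda>t. f (p \<otimes>\<^bsub>G\<^esub> E (t *\<^sub>R x))) has_real_derivative L x (\<lambda>h. f (p \<otimes>\<^bsub>G\<^esub> h)) \<one>\<^bsub>G\<^esub>) (at 0)"
    using exp_map smooth_fun_translate(1)[OF assms] unfolding exponential_map_def by blast
  then show ?thesis by (simp add: L_left_translate[OF assms])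
qed

text \<open>\<open>L (Ad g x) f p\<close> is the derivative in \<open>\<sigma>\<close> of \<open>f (p g E(\<sigma> x) g\<^sup>-\<^sup>1)\<close>. With the two
  occurrences of \<open>g = E(t u)\<close> separated into independent parameters \<open>h\<close> and \<open>k\<close>, the
  derivative of the first is a value of \<open>L u (L x f)\<close>, that of the second, after
  exchanging the order of differentiation, a value of \<open>- L x (L u f)\<close>.\<close>

lemma Ad_E_derivative_0:
  assumes f: "smooth_fun A f"
  shows "((\<lambda>t. L (Ad G A L (E (t *\<^sub>R u)) x) f p) has_real_derivative L (br u x) f p) (at 0)"
proof -
  \<comment> \<open>the argument is \<open>((h, k), \<sigma>)\<close>\<close>
  define F :: "(real \<times> real) \<times> real \<Rightarrow> real" where
    "F = (\<lambda>y. f (p \<otimes>\<^bsub>G\<^esub> E (fst (fst y) *\<^sub>R u) \<otimes>\<^bsub>G\<^esub> E (snd y *\<^sub>R x) \<otimes>\<^bsub>G\<^esub> E ((- snd (fst y)) *\<^sub>R u)))"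
  define D where "D v y = frechet_derivative F (at y) v" for v y
  have lin: "bounded_linear (\<lambda>y::(real \<times> real) \<times> real. fst (fst y))"
    "bounded_linear (\<lambda>y::(real \<times> real) \<times> real. - snd (fst y))"
    "bounded_linear (\<lambda>y::(real \<times> real) \<times> real. snd y)"
    by (intro bounded_linear_minus bounded_linear_compose[OF bounded_linear_fst]
        bounded_linear_compose[OF bounded_linear_snd] bounded_linear_fst bounded_linear_snd
        bounded_linear_ident)+
  have "smooth_fun vector_atlas F"
    unfolding F_def
    by (intro smooth_fun_compose[OF smooth_atlas_vector_atlas atlas _ f] smooth_map_mult
        smooth_map_const smooth_map_E lin smooth_atlas_vector_atlas)
  then have Ck: "Ck_on k UNIV F" for k
    by (simp add: smooth_fun_vector_atlas smooth_on_def)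
  have F: "F differentiable (at y)" for y
    using Ck[of "Suc 0"] unfolding Ck_on.simps by blast
  have D: "D v differentiable (at y)" for v y
    using Ck[of "Suc (Suc 0)"] unfolding Ck_on.simps D_def by blast
  note line = has_real_derivative_line
  have D\<sigma>: "D (0, 1) ((h, k), 0) = L x (\<lambda>q. f (q \<otimes>\<^bsub>G\<^esub> E ((- k) *\<^sub>R u))) (p \<otimes>\<^bsub>G\<^esub> E (h *\<^sub>R u))" for h k
  proof (rule DERIV_unique)
    show "((\<lambda>t. F (((h, k), 0) + t *\<^sub>R (0, 1))) has_real_derivative D (0, 1) ((h, k), 0)) (at 0)"
      unfolding D_def by (rule line[OF F])
    show "((\<lambda>t. F (((h, k), 0) + t *\<^sub>R (0, 1))) has_real_derivative
        L x (\<lambda>q. f (q \<otimes>\<^bsub>G\<^esub> E ((- k) *\<^sub>R u))) (p \<otimes>\<^bsub>G\<^esub> E (h *\<^sub>R u))) (at 0)"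
      using L_derivative[OF smooth_fun_translate(2)[OF f, of "E ((- k) *\<^sub>R u)"],
          where p = "p \<otimes>\<^bsub>G\<^esub> E (h *\<^sub>R u)" and x = x]
      by (simp add: F_def)
  qed
  have Dk: "D ((0, 1), 0) ((0, 0), \<sigma>) = - L u f (p \<otimes>\<^bsub>G\<^esub> E (\<sigma> *\<^sub>R x))" for \<sigma>
  proof (rule DERIV_unique)
    show "((\<lambda>t. F (((0, 0), \<sigma>) + t *\<^sub>R ((0, 1), 0))) has_real_derivative D ((0, 1), 0) ((0, 0), \<sigma>)) (at 0)"
      unfolding D_def by (rule line[OF F])
    have "((\<lambda>t. f (p \<otimes>\<^bsub>G\<^esub> E (\<sigma> *\<^sub>R x) \<otimes>\<^bsub>G\<^esub> E ((- t) *\<^sub>R u))) has_real_derivative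
        L u f (p \<otimes>\<^bsub>G\<^esub> E (\<sigma> *\<^sub>R x)) * (- 1)) (at 0)"
      by (rule DERIV_chain2[where g = uminus])
         (auto intro!: derivative_eq_intros L_derivative[OF f, simplified])
    then show "((\<lambda>t. F (((0, 0), \<sigma>) + t *\<^sub>R ((0, 1), 0))) has_real_derivative
        - L u f (p \<otimes>\<^bsub>G\<^esub> E (\<sigma> *\<^sub>R x))) (at 0)"
      by (simp add: F_def E_0)
  qed
  define K where "K = frechet_derivative (D (0, 1)) (at ((0, 0), 0))"
  have K: "((\<lambda>t. D (0, 1) (((0, 0), 0) + t *\<^sub>R v)) has_real_derivative K v) (at 0)" for v
    unfolding K_def by (rule line[OF D])
  have Kh: "K ((1, 0), 0) = L u (L x f) p"
  proof (rule DERIV_unique[OF K])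
    show "((\<lambda>t. D (0, 1) (((0, 0), 0) + t *\<^sub>R ((1, 0), 0))) has_real_derivative L u (L x f) p) (at 0)"
      using L_derivative[OF L_smooth[OF f], of x p u] by (simp add: D\<sigma> E_0)
  qed
  have "K ((0, 1), 0) = frechet_derivative (D ((0, 1), 0)) (at ((0, 0), 0)) (0, 1)"
    unfolding K_def D_def [abs_def] by (rule frechet_derivative_symmetric[OF Ck])
  also have "\<dots> = - L x (L u f) p"
  proof (rule DERIV_unique[OF line[OF D]])
    show "((\<lambda>t. D ((0, 1), 0) (((0, 0), 0) + t *\<^sub>R (0, 1))) has_real_derivative - L x (L u f) p) (at 0)"
      using DERIV_minus[OF L_derivative[OF L_smooth[OF f], of u p x]] by (simp add: Dk)
  qed
  finally have Kk: "K ((0, 1), 0) = - L x (L u f) p" .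
  \<comment> \<open>\<open>Ad (E (t u))\<close> corresponds to the diagonal \<open>h = k = t\<close>\<close>
  have "linear K" unfolding K_def using linear_frechet_derivative[OF D] .
  from linear_add[OF this, of "((1, 0), 0)" "((0, 1), 0)"]
  have "K ((1, 1), 0) = L (br u x) f p" by (simp add: Kh Kk L_bracket)
  then show ?thesis
    using K[of "((1, 1), 0)"] by (simp add: D\<sigma> Ad_L[OF f] inv_E)
qed

text \<open>As \<open>Ad(E((t + h) u)) = Ad(E(t u)) Ad(E(h u))\<close>, the derivative at \<open>0\<close> determines the one at \<open>t\<close>.
  The homomorphism property is used in terms of functions: \<open>Ad(E(t u))\<close> amounts to right translation of
  \<open>f\<close> and \<open>p\<close>, so that no derivative of a curve in \<open>'g\<close> is needed.\<close>

lemma Ad_E_derivative: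
  assumes f: "smooth_fun A f"
  shows "((\<lambda>t. L (Ad G A L (E (t *\<^sub>R u)) x) f p) has_real_derivative
    L (Ad G A L (E (t *\<^sub>R u)) (br u x)) f p) (at t)"
proof (rule has_real_derivative_translate)
  let ?f = "\<lambda>q. f (q \<otimes>\<^bsub>G\<^esub> E ((- t) *\<^sub>R u))" and ?p = "p \<otimes>\<^bsub>G\<^esub> E (t *\<^sub>R u)"
  have sf: "smooth_fun A ?f" using f by (rule smooth_fun_translate(2))
  have E: "inv\<^bsub>G\<^esub> (E (t *\<^sub>R u) \<otimes>\<^bsub>G\<^esub> E (h *\<^sub>R u)) = E ((- h) *\<^sub>R u) \<otimes>\<^bsub>G\<^esub> E ((- t) *\<^sub>R u)" for h
    by (simp add: inv_mult_group inv_E)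
  have split: "L (Ad G A L (E ((t + h) *\<^sub>R u)) x) f p = L (Ad G A L (E (h *\<^sub>R u)) x) ?f ?p" for h
    by (simp only: Ad_L[OF f] Ad_L[OF sf] E_add E inv_E m_assoc in_carrier m_closed)
  show "((\<lambda>h. L (Ad G A L (E ((t + h) *\<^sub>R u)) x) f p) has_real_derivative
      L (Ad G A L (E (t *\<^sub>R u)) (br u x)) f p) (at 0)"
    using Ad_E_derivative_0[OF sf, of u x ?p] unfolding split by (simp add: Ad_L[OF f] inv_E)
qed

lemma Ad_one: "Ad G A L \<one>\<^bsub>G\<^esub> x = x"
  by (rule L_eqI) (simp add: Ad_L)

lemma Ad_zero: "Ad G A L g 0 = 0"
  by (rule L_eqI) (simp add: Ad_L L_zero)

text \<open>The curve \<open>Ad(E(t u)) [u, x]\<close> has derivative \<open>Ad(E(t u)) [u, [u, x]] = 0\<close>, so it is constant, and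
  it is the derivative of \<open>Ad(E(t u)) x\<close>.\<close>

lemma Ad_E_two_step:
  assumes "\<And>x. br u (br u x) = 0"
  shows "Ad G A L (E (t *\<^sub>R u)) x = x + t *\<^sub>R br u x"
proof (rule L_eqI)
  fix f :: "'a \<Rightarrow> real" assume f: "smooth_fun A f"
  have E0: "Ad G A L (E (0 *\<^sub>R u)) x = x" for x by (simp add: E_0 Ad_one)
  have "((\<lambda>t. L (Ad G A L (E (t *\<^sub>R u)) (br u x)) f \<one>\<^bsub>G\<^esub>) has_real_derivative 0) (at t)" for t
    using Ad_E_derivative[OF f, of u "br u x" _ t] by (simp add: assms Ad_zero L_zero)
  from linear_of_constant_derivative[OF this]
  have "L (Ad G A L (E (t *\<^sub>R u)) (br u x)) f \<one>\<^bsub>G\<^esub> = L (br u x) f \<one>\<^bsub>G\<^esub>" for t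
    using E0 by simp
  then have "((\<lambda>t. L (Ad G A L (E (t *\<^sub>R u)) x) f \<one>\<^bsub>G\<^esub>) has_real_derivative L (br u x) f \<one>\<^bsub>G\<^esub>) (at t)" for t
    using Ad_E_derivative[OF f, of u x "\<one>\<^bsub>G\<^esub>" t] by simp
  from linear_of_constant_derivative[OF this]
  show "L (Ad G A L (E (t *\<^sub>R u)) x) f \<one>\<^bsub>G\<^esub> = L (x + t *\<^sub>R br u x) f \<one>\<^bsub>G\<^esub>"
    using E0 by (simp add: L_add L_scale)
qed

end

section \<open>Multiplicative bivector fields along one-parameter subgroups\<close>

lemma blinfun2_eqI: "(\<And>\<alpha> \<beta>. blinfun_apply (blinfun_apply b \<alpha>) \<beta> = blinfun_apply (blinfun_apply c \<alpha>) \<beta>) \<Longrightarrow> b = c"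
  by (intro blinfun_eqI)

context lie_group_with_exp
begin

text \<open>The multiplicativity of \<open>Q\<close> turns the derivative \<open>\<xi> u\<close> of \<open>t \<mapsto> Q (E (t u))\<close> at \<open>0\<close>
  into the derivative \<open>Ad(E(t u)) (\<xi> u)\<close> at \<open>t\<close>. As \<open>Ad(E(t u)) = 1 + t ad u\<close> on \<open>'g\<close>, this is
  a polynomial in \<open>t\<close> whose quadratic coefficient is \<open>(ad u \<otimes> ad u) (\<xi> u)\<close>.\<close>

lemma multiplicative_tensor_E:
  assumes mpt: "multiplicative_poisson_tensor G A L \<xi> \<pi> Q"
    and lin: "linear (br u)" and nil: "\<And>x. br u (br u x) = 0"
    and quad: "\<And>\<alpha> \<beta>. \<xi> u (pullback (br u) \<alpha>) (pullback (br u) \<beta>) = 0"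
  shows "Q (E u) = \<xi> u + (1/2) *\<^sub>R ext_der (br u) (\<xi> u)"
proof (rule blinfun2_eqI)
  fix \<alpha> \<beta> :: "'g dual"
  define f where "f t = Q (E (t *\<^sub>R u)) \<alpha> \<beta>" for t
  let ?pb = "\<lambda>t \<gamma>. \<gamma> + t *\<^sub>R pullback (br u) \<gamma>"
  have Q_mult: "Q (g \<otimes>\<^bsub>G\<^esub> h) = Q g + ext_mult (Ad G A L g) (Q h)" for g h
    using mpt unfolding multiplicative_poisson_tensor_def by blast
  have "smooth_fun A (\<lambda>g. Q g a b)" for a b
  proof (rule smooth_fun_linear_image[OF atlas, where f = Q and T = "\<lambda>c. c a b"])
    show "smooth_fun A Q" using mpt unfolding multiplicative_poisson_tensor_def by blast
    show "bounded_linear (\<lambda>c :: 'g bivec. c a b)"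
      by (intro bounded_linear_compose[OF blinfun.bounded_linear_left] blinfun.bounded_linear_left)
  qed
  from L_derivative[OF this, where p = "\<one>\<^bsub>G\<^esub>" and x = u]
  have der0: "((\<lambda>t. Q (E (t *\<^sub>R u)) a b) has_real_derivative \<xi> u a b) (at 0)" for a b
    using mpt by (simp add: multiplicative_poisson_tensor_def)
  have step: "f (t + h) = f t + Q (E (h *\<^sub>R u)) (?pb t \<alpha>) (?pb t \<beta>)" for t h
  proof -
    have linT: "linear (\<lambda>x. x + t *\<^sub>R br u x)"
      using lin by (simp add: linear_iff algebra_simps)
    have "pullback (\<lambda>x. x + t *\<^sub>R br u x) \<gamma> = ?pb t \<gamma>" for \<gamma>
      by (rule blinfun_eqI)
         (simp add: pullback_apply linT lin blinfun.add_left blinfun.add_right blinfun.scaleR_left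
           blinfun.scaleR_right)
    moreover have "Ad G A L (E (t *\<^sub>R u)) = (\<lambda>x. x + t *\<^sub>R br u x)"
      by (rule ext) (rule Ad_E_two_step[OF nil])
    ultimately show ?thesis
      by (simp add: f_def E_add Q_mult ext_mult_apply linT blinfun.add_left)
  qed
  have pb: "\<xi> u (?pb t \<alpha>) (?pb t \<beta>) = \<xi> u \<alpha> \<beta> + t * ext_der (br u) (\<xi> u) \<alpha> \<beta>" for t
    by (simp add: ext_der_apply lin quad blinfun.add_left blinfun.add_right blinfun.scaleR_left
        blinfun.scaleR_right algebra_simps)
  have f': "(f has_real_derivative \<xi> u \<alpha> \<beta> + t * ext_der (br u) (\<xi> u) \<alpha> \<beta>) (at t)" for t
    by (rule has_real_derivative_translate)
       (use DERIV_add[OF DERIV_const der0, of "f t" "?pb t \<alpha>" "?pb t \<beta>"] in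
         \<open>simp add: step pb\<close>)
  \<comment> \<open>the difference of \<open>f\<close> and the antiderivative of \<open>f'\<close> that vanishes at \<open>0\<close>\<close>
  define k where "k t = f t - (t * \<xi> u \<alpha> \<beta> + t\<^sup>2 / 2 * ext_der (br u) (\<xi> u) \<alpha> \<beta>)" for t
  have "(k has_real_derivative 0) (at t)" for t
    unfolding k_def by (auto intro!: derivative_eq_intros f')
  then have "k 1 = k 0" using DERIV_isconst_all[of k 1 0] by simp
  moreover have "f 0 = 0" using step[of 0 0] by (simp add: f_def)
  ultimately show "Q (E u) \<alpha> \<beta> = (\<xi> u + (1/2) *\<^sub>R ext_der (br u) (\<xi> u)) \<alpha> \<beta>"
    by (simp add: k_def f_def blinfun.add_left blinfun.scaleR_left)
qed

end

section \<open>Normalized cocycles on the nilradical\<close>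

lemma lie_bracket_linear:
  assumes "lie_bracket br"
  shows "linear (br x)" "linear (\<lambda>x. br x y)"
  using assms unfolding lie_bracket_def bilinear_def by auto

lemma lie_bracket_derived: "br x y \<in> derived_algebra br"
  unfolding derived_algebra_def by (rule span_base) auto

lemma lie_center_bracket: "x \<in> lie_center br \<Longrightarrow> br x y = 0"
  unfolding lie_center_def by simp

lemma pullback_square_zero:
  assumes "linear T" "\<And>x. T (T x) = 0"
  shows "pullback T (pullback T \<alpha>) = 0"
  by (rule blinfun_eqI) (simp add: pullback_apply assms)

text \<open>Here \<open>u = z + v\<close>. The contributions of \<open>r\<close> and \<open>R z\<close> to the second statement vanish because of the
  first one, \<open>(ad u)\<^sup>2 = 0\<close>; that of \<open>R v\<close> because \<open>ad u\<close> annihilates the factor in \<open>P\<^sub>l\<close> of each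
  wedge product.\<close>

lemma normalized_cocycle_quadratic_zero:
  fixes br :: "'g::euclidean_space \<Rightarrow> 'g \<Rightarrow> 'g"
  assumes br: "lie_bracket br" and m: "milnor_decomposition br s m P w J"
    and R: "normalized_cocycle br s m P R"
    and z: "z \<in> lie_center br" and v: "v \<in> derived_algebra br"
  shows "\<And>x. br (z + v) (br (z + v) x) = 0"
    and "(ext_der (br (z + v)) r + R (z + v))
      (pullback (br (z + v)) \<alpha>) (pullback (br (z + v)) \<beta>) = 0"
proof -
  define T where "T = br (z + v)"
  have T: "linear T" unfolding T_def by (rule lie_bracket_linear[OF br])
  have Tv: "T x = br v x" for x
    unfolding T_def using linear_add[OF lie_bracket_linear(2)[OF br], of z v x] lie_center_bracket[OF z] by simp
  have u_abelian: "\<forall>x\<in>derived_algebra br. \<forall>y\<in>derived_algebra br. br x y = 0"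
    using m unfolding milnor_decomposition_def Let_def by (elim conjE)
  have s: "subspace s"
    using m unfolding milnor_decomposition_def Let_def by (elim conjE)
  have u_span: "derived_algebra br = span (\<Union>l\<in>{1..m}. P l)"
    using m unfolding milnor_decomposition_def Let_def by (elim conjE)
  have T_derived: "T y = 0" if "y \<in> derived_algebra br" for y
    using Tv u_abelian v that by simp
  have TT: "T (T x) = 0" for x
    by (rule T_derived) (simp add: T_def lie_bracket_derived)
  show "br (z + v) (br (z + v) x) = 0" for x using TT by (simp add: T_def)
  \<comment> \<open>the form \<open>(ad u \<otimes> ad u) b\<close>, evaluated at \<open>\<alpha>\<close> and \<open>\<beta>\<close>\<close>
  define q where "q b = b (pullback T \<alpha>) (pullback T \<beta>)" for b :: "'g bivec"
  have q: "linear q"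
    unfolding q_def by (rule linearI) (simp_all add: blinfun.add_left blinfun.scaleR_left)
  note pb2 = pullback_square_zero[OF T TT]
  have "q (ext_der T r) = 0" by (simp add: q_def ext_der_apply T pb2)
  moreover have "q (R z) = 0"
  proof -
    have "R (0 + z) \<in> invariant_bivectors br"
      using R z subspace_0[OF s] unfolding normalized_cocycle_def by blast
    \<comment> \<open>invariance with \<open>ad u\<close> already applied in the second slot\<close>
    then have "ext_der T (R z) \<alpha> (pullback T \<beta>) = 0"
      unfolding invariant_bivectors_def T_def by simp
    then show ?thesis by (simp add: ext_der_apply T pb2 q_def)
  qed
  moreover have "q (R v) = 0"
  proof -
    have linR: "linear R" using R unfolding normalized_cocycle_def cocycle_def by blast
    have wedge0: "q b = 0" if "b \<in> wedge_space W (P l)" "l \<in> {1..m}" for b W l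
    proof -
      have "q (wedge x y) = 0" if "y \<in> P l" for x y
      proof -
        have "y \<in> derived_algebra br" using that \<open>l \<in> {1..m}\<close>
          unfolding u_span by (intro span_base) auto
        then show ?thesis by (simp add: q_def wedge_apply pullback_apply T T_derived)
      qed
      then show ?thesis
        by (intro linear_eq_0_on_span[OF q _ that(1)[unfolded wedge_space_def]]) auto
    qed
    have "q (R y) = 0" if y: "y \<in> P l" "l \<in> {1..m}" for y l
    proof -
      obtain b c where "R y = b + c" "b \<in> wedge_space s (P l)" "c \<in> wedge_space (lie_center br) (P l)"
        using R y unfolding normalized_cocycle_def by blast
      then show ?thesis using wedge0 y(2) linear_add[OF q] by simp
    qed
    then have "(q \<circ> R) v = 0"
      by (intro linear_eq_0_on_span[OF linear_compose[OF linR q] _ v[unfolded u_span]]) fastforce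
    then show ?thesis by simp
  qed
  moreover have "R (z + v) = R z + R v"
    using R unfolding normalized_cocycle_def cocycle_def by (simp add: linear_add)
  ultimately have "q (ext_der T r + R (z + v)) = 0" by (simp add: linear_add[OF q])
  then show "(ext_der (br (z + v)) r + R (z + v))
      (pullback (br (z + v)) \<alpha>) (pullback (br (z + v)) \<beta>) = 0"
    by (simp add: q_def T_def)
qed

lemma bivector_antisym:
  fixes b :: "'g::euclidean_space bivec"
  assumes "b \<in> bivectors"
  shows "b \<alpha> \<beta> = - b \<beta> \<alpha>"
proof -
  have "b (\<alpha> + \<beta>) (\<alpha> + \<beta>) = 0" "b \<alpha> \<alpha> = 0" "b \<beta> \<beta> = 0"
    using assms unfolding bivectors_def by blast+
  then show ?thesis by (simp add: blinfun.add_left blinfun.add_right)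
qed

lemma ext_der_bivectors:
  assumes "linear T" "b \<in> bivectors"
  shows "ext_der T b \<in> bivectors"
  unfolding bivectors_def
proof (intro CollectI allI)
  show "ext_der T b \<alpha> \<alpha> = 0" for \<alpha>
    using bivector_antisym[OF assms(2), of "pullback T \<alpha>" \<alpha>] by (simp add: ext_der_apply assms(1))
qed

lemma ext_der_bracket_bilinear:
  fixes br :: "'g::euclidean_space \<Rightarrow> 'g \<Rightarrow> 'g"
  assumes "lie_bracket br"
  shows "bilinear (\<lambda>x. ext_der (br x))"
proof -
  note lin = lie_bracket_linear[OF assms]
  have add: "pullback (br (x + y)) \<alpha> = pullback (br x) \<alpha> + pullback (br y) \<alpha>" for x y \<alpha>
    by (rule blinfun_eqI) (simp add: pullback_apply lin linear_add[OF lin(2)] blinfun.add_left blinfun.add_right)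
  have scale: "pullback (br (c *\<^sub>R x)) \<alpha> = c *\<^sub>R pullback (br x) \<alpha>" for x c \<alpha>
    by (rule blinfun_eqI) (simp add: pullback_apply lin linear_scale[OF lin(2)] blinfun.scaleR_left blinfun.scaleR_right)
  show ?thesis
    unfolding bilinear_def
    by (intro conjI allI linearI blinfun2_eqI)
       (simp_all add: ext_der_apply lin add scale blinfun.add_left blinfun.add_right
         blinfun.scaleR_left blinfun.scaleR_right algebra_simps)
qed

section \<open>Polynomials in linear coordinates\<close>

lemma finite_multi_indices:
  assumes "finite C"
  shows "finite {e :: 'v \<Rightarrow> nat. (\<forall>c. c \<notin> C \<longrightarrow> e c = 0) \<and> (\<Sum>c\<in>C. e c) \<le> d}"
proof (rule finite_subset)
  show "{e. (\<forall>c. c \<notin> C \<longrightarrow> e c = 0) \<and> (\<Sum>c\<in>C. e c) \<le> d}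
      \<subseteq> {e. \<forall>c. (c \<in> C \<longrightarrow> e c \<in> {..d}) \<and> (c \<notin> C \<longrightarrow> e c = 0)}"
  proof (clarsimp, goal_cases)
    case (1 e c)
    then show ?case using member_le_sum[of c C e] assms by simp
  qed
  show "finite {e :: 'v \<Rightarrow> nat. \<forall>c. (c \<in> C \<longrightarrow> e c \<in> {..d}) \<and> (c \<notin> C \<longrightarrow> e c = 0)}"
    by (rule finite_set_of_finite_funs) (use assms in auto)
qed

lemma polynomial_cong:
  assumes "polynomial_of_degree_le d C f" "\<And>u. u \<in> span C \<Longrightarrow> g u = f u"
  shows "polynomial_of_degree_le d C g"
  using assms unfolding polynomial_of_degree_le_def by simp

lemma polynomial_add:
  assumes "polynomial_of_degree_le d C f" "polynomial_of_degree_le d C g"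
  shows "polynomial_of_degree_le d C (\<lambda>u. f u + g u)"
proof -
  from assms obtain a b where
    "\<forall>u\<in>span C. f u = (\<Sum>e\<in>{e. (\<forall>c. c \<notin> C \<longrightarrow> e c = 0) \<and> (\<Sum>c\<in>C. e c) \<le> d}.
              a e * (\<Prod>c\<in>C. representation C u c ^ e c))"
    "\<forall>u\<in>span C. g u = (\<Sum>e\<in>{e. (\<forall>c. c \<notin> C \<longrightarrow> e c = 0) \<and> (\<Sum>c\<in>C. e c) \<le> d}.
              b e * (\<Prod>c\<in>C. representation C u c ^ e c))"
    unfolding polynomial_of_degree_le_def by blast
  then show ?thesis
    unfolding polynomial_of_degree_le_def
    by (intro exI[of _ "\<lambda>e. a e + b e"]) (simp add: sum.distrib ring_distribs)
qed

lemma polynomial_scale: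
  assumes "polynomial_of_degree_le d C f"
  shows "polynomial_of_degree_le d C (\<lambda>u. k * f u)"
proof -
  from assms obtain a where
    "\<forall>u\<in>span C. f u = (\<Sum>e\<in>{e. (\<forall>c. c \<notin> C \<longrightarrow> e c = 0) \<and> (\<Sum>c\<in>C. e c) \<le> d}.
              a e * (\<Prod>c\<in>C. representation C u c ^ e c))"
    unfolding polynomial_of_degree_le_def by blast
  then show ?thesis
    unfolding polynomial_of_degree_le_def
    by (intro exI[of _ "\<lambda>e. k * a e"]) (simp add: sum_distrib_left mult_ac)
qed

lemma polynomial_zero: "polynomial_of_degree_le d C (\<lambda>u. 0)"
  unfolding polynomial_of_degree_le_def by (rule exI[of _ "\<lambda>e. 0"]) simp

lemma polynomial_sum:
  "(\<And>i. i \<in> I \<Longrightarrow> polynomial_of_degree_le d C (f i)) \<Longrightarrow>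
    polynomial_of_degree_le d C (\<lambda>u. \<Sum>i\<in>I. f i u)"
  by (induction I rule: infinite_finite_induct) (auto intro: polynomial_zero polynomial_add)

lemma polynomial_monomial:
  assumes "finite C" "\<forall>c. c \<notin> C \<longrightarrow> e0 c = 0" "(\<Sum>c\<in>C. e0 c) \<le> d"
  shows "polynomial_of_degree_le d C (\<lambda>u. \<Prod>c\<in>C. representation C u c ^ e0 c)"
  unfolding polynomial_of_degree_le_def
proof (intro exI ballI)
  fix u
  let ?I = "{e. (\<forall>c. c \<notin> C \<longrightarrow> e c = 0) \<and> (\<Sum>c\<in>C. e c) \<le> d}"
  have "(\<Sum>e\<in>?I. of_bool (e = e0) * (\<Prod>c\<in>C. representation C u c ^ e c)) =
      (\<Sum>e\<in>?I. if e = e0 then \<Prod>c\<in>C. representation C u c ^ e0 c else 0)"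
    by (rule sum.cong) auto
  then show "(\<Prod>c\<in>C. representation C u c ^ e0 c) =
      (\<Sum>e\<in>?I. of_bool (e = e0) * (\<Prod>c\<in>C. representation C u c ^ e c))"
    using assms by (simp add: finite_multi_indices)
qed

lemma prod_power_single:
  fixes x :: "'v \<Rightarrow> real"
  assumes "finite C" "c \<in> C"
  shows "(\<Prod>i\<in>C. x i ^ of_bool (i = c)) = x c"
proof -
  have "(\<Prod>i\<in>C. x i ^ of_bool (i = c)) = (\<Prod>i\<in>C. if i = c then x i else 1)"
    by (rule prod.cong) auto
  then show ?thesis using assms by simp
qed

lemma polynomial_coordinate:
  assumes "finite C" "c \<in> C" "1 \<le> d"
  shows "polynomial_of_degree_le d C (\<lambda>u. representation C u c)"
proof -
  have "\<forall>i. i \<notin> C \<longrightarrow> of_bool (i = c) = (0 :: nat)" "(\<Sum>i\<in>C. of_bool (i = c)) = (1 :: nat)"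
    using assms by (auto simp: of_bool_def)
  then show ?thesis
    using polynomial_monomial[of C "\<lambda>i. of_bool (i = c)" d] assms
    by (simp add: prod_power_single)
qed

text \<open>As a sum of two unit multi-indices the exponent covers the case \<open>c = c'\<close> as well.\<close>

lemma polynomial_coordinate_mult:
  assumes "finite C" "c \<in> C" "c' \<in> C" "2 \<le> d"
  shows "polynomial_of_degree_le d C (\<lambda>u. representation C u c * representation C u c')"
proof -
  have "\<forall>i. i \<notin> C \<longrightarrow> of_bool (i = c) + of_bool (i = c') = (0 :: nat)"
    using assms by auto
  moreover have "(\<Sum>i\<in>C. of_bool (i = c) + of_bool (i = c')) = (2 :: nat)"
    using assms by (simp add: sum.distrib of_bool_def)
  ultimately show ?thesis
    using polynomial_monomial[of C "\<lambda>i. of_bool (i = c) + of_bool (i = c')" d] assms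
    by (simp add: power_add prod.distrib prod_power_single)
qed

lemma polynomial_linear_plus_quadratic:
  fixes l :: "'v::euclidean_space \<Rightarrow> real"
  assumes C: "independent C" and l: "linear l" and q: "bilinear q"
  shows "polynomial_of_degree_le 2 C (\<lambda>u. l u + q u u)"
proof -
  have fin: "finite C" using C by (rule independent_imp_finite)
  let ?x = "representation C"
  have "polynomial_of_degree_le 2 C
      (\<lambda>u. (\<Sum>c\<in>C. l c * ?x u c) + (\<Sum>p\<in>C \<times> C. q (fst p) (snd p) * (?x u (fst p) * ?x u (snd p))))"
    by (intro polynomial_add polynomial_sum polynomial_scale polynomial_coordinate
        polynomial_coordinate_mult fin) auto
  then show ?thesis
  proof (rule polynomial_cong)
    fix u assume "u \<in> span C"
    then have u: "(\<Sum>c\<in>C. ?x u c *\<^sub>R c) = u"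
      using sum_representation_eq[OF C _ fin] by simp
    have "l u = (\<Sum>c\<in>C. l c * ?x u c)"
      by (subst u[symmetric]) (simp add: linear_sum[OF l] linear_scale[OF l] mult.commute)
    moreover have "q (\<Sum>c\<in>C. ?x u c *\<^sub>R c) (\<Sum>c\<in>C. ?x u c *\<^sub>R c) =
        (\<Sum>p\<in>C \<times> C. q (fst p) (snd p) * (?x u (fst p) * ?x u (snd p)))"
      unfolding bilinear_sum[OF q]
      by (rule sum.cong) (auto simp: bilinear_lmul[OF q] bilinear_rmul[OF q])
    ultimately show "l u + q u u =
        (\<Sum>c\<in>C. l c * ?x u c) + (\<Sum>p\<in>C \<times> C. q (fst p) (snd p) * (?x u (fst p) * ?x u (snd p)))"
      by (simp add: u)
  qed
qed

section \<open>Polynomiality along the nilradical\<close>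

theorem corollary7p3:
  fixes br :: "'g::euclidean_space \<Rightarrow> 'g \<Rightarrow> 'g"
    and G :: "('a::{t2_space, second_countable_topology}) monoid"
    and A :: "('a, 'e::euclidean_space) chart set"
    and L :: "'g \<Rightarrow> 'a vfield"
    and E :: "'g \<Rightarrow> 'a"
    and s :: "'g set" and m :: nat and P :: "nat \<Rightarrow> 'g set"
    and w :: "nat \<Rightarrow> 'g \<Rightarrow> real" and J :: "nat \<Rightarrow> 'g \<Rightarrow> 'g"
    and r :: "'g bivec" and R \<xi> :: "'g \<Rightarrow> 'g bivec"
    and \<pi> :: "('a \<Rightarrow> real) \<Rightarrow> ('a \<Rightarrow> real) \<Rightarrow> 'a \<Rightarrow> real"
    and Q :: "'a \<Rightarrow> 'g bivec"
    and B :: "'g bivec set" and C :: "'g set"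
  assumes "lie_bracket br"
    and "lie_group G A" and "simply_connected (UNIV :: 'a set)"
    and "lie_algebra_of G A br L"
    and "flat_metric A (left_invariant_metric L)"
    and "milnor_decomposition br s m P w J"
    and "nondegenerate_weights s m w"
    and "r \<in> bivectors" and "normalized_cocycle br s m P R"
    and "\<xi> = (\<lambda>x. ext_der (br x) r + R x)"
    and "lie_bialgebra_structure br \<xi>"
    and "multiplicative_poisson_tensor G A L \<xi> \<pi> Q"
    and "exponential_map G A L E"
    and "basis_of B bivectors"
    and "basis_of C {x + y | x y. x \<in> lie_center br \<and> y \<in> derived_algebra br}"
  shows "\<forall>b\<in>B. polynomial_of_degree_le 2 C (\<lambda>u. representation B (Q (E u)) b)"
proof
  fix b
  interpret lie_group_with_exp G A br L E
    using assms(2,4,13) by unfold_locales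
  have Q: "Q (E u) = \<xi> u + (1/2) *\<^sub>R ext_der (br u) (\<xi> u)" if "u \<in> span C" for u
  proof -
    have "u \<in> {x + y | x y. x \<in> lie_center br \<and> y \<in> derived_algebra br}"
      using that assms(15) unfolding basis_of_def by simp
    then obtain z v where u: "u = z + v" "z \<in> lie_center br" "v \<in> derived_algebra br"
      by blast
    note zero = normalized_cocycle_quadratic_zero[OF assms(1,6,9) u(2,3)]
    show ?thesis
      by (rule multiplicative_tensor_E[OF assms(12) lie_bracket_linear(1)[OF assms(1)]])
         (simp_all add: u(1) zero assms(10))
  qed
  have B: "independent B" "span B = bivectors" and C: "independent C"
    using assms(14,15) unfolding basis_of_def by blast+
  have \<xi>: "linear \<xi>" "\<xi> u \<in> span B" for u
    using assms(11) unfolding lie_bialgebra_structure_def cocycle_def B(2) by blast+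
  then have ext: "ext_der (br u) (\<xi> v) \<in> span B" for u v
    unfolding B(2) by (intro ext_der_bivectors lie_bracket_linear(1)[OF assms(1)])
  let ?q = "\<lambda>u v. (1/2) * representation B (ext_der (br u) (\<xi> v)) b"
  note ext_bil = ext_der_bracket_bilinear[OF assms(1)]
  have "linear (\<lambda>u. representation B (\<xi> u) b)"
    by (rule linearI)
       (simp_all add: linear_add[OF \<xi>(1)] linear_scale[OF \<xi>(1)] representation_add
         representation_scale B(1) \<xi>(2))
  moreover have "bilinear ?q"
    unfolding bilinear_def
    by (intro conjI allI linearI)
       (simp_all add: linear_add[OF \<xi>(1)] linear_scale[OF \<xi>(1)] representation_add
         representation_scale B(1) ext bilinear_ladd[OF ext_bil] bilinear_radd[OF ext_bil]
         bilinear_lmul[OF ext_bil] bilinear_rmul[OF ext_bil] algebra_simps)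
  ultimately have "polynomial_of_degree_le 2 C (\<lambda>u. representation B (\<xi> u) b + ?q u u)"
    by (rule polynomial_linear_plus_quadratic[OF C])
  then show "polynomial_of_degree_le 2 C (\<lambda>u. representation B (Q (E u)) b)"
    by (rule polynomial_cong)
       (simp add: Q representation_add representation_scale B(1) \<xi>(2) ext span_scale)
qed

end
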